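(* Let $(\mathcal{X},d)$ be a complete, separable, non-compact, locally compact length space and $p>1$. If $(\mu_t)_{t\ge0}$ is a unit-speed ray in $P_p(\mathcal{X})$, then its Busemann function $b_\mu$ belongs to the metric viscosity class $\mathcal{V}(P_p(\mathcal{X}))$, i.e. for every $\nu\in P_p(\mathcal{X})$, $$b_\mu(\nu)=\min_{\lambda\in P_p(\mathcal{X})\setminus\{\nu\}}\{W_p(\nu,\lambda)+b_\mu(\lambda)\},$$ the minimum being attained.
   Context: $P_p(\mathcal{X})$: Borel probability measures on $\mathcal{X}$ with finite $p$-th moment, with $W_p(\mu,\nu)=\big(\min_{\pi}\int d(x,y)^p\,d\pi\big)^{1/p}$ over couplings $\pi$ of $\mu,\nu$. A ray in a metric space $(\mathcal{Y},d)$ is a continuous $\gamma:[0,\infty)\to\mathcal{Y}$ with $d(\gamma_s,\gamma_t)=|s-t|\,d(\gamma_0,\gamma_1)$; unit-speed means $d(\gamma_0,\gamma_1)=1$. Busemann function: $b_\mu(\lambda)=\lim_{t\to+\infty}[W_p(\lambda,\mu_t)-t]$ for $\lambda\in P_p(\mathcal{X})$ (the limit exists and is finite). For a metric space $(\mathcal{Y},d)$, the metric viscosity class is $\mathcal{V}(\mathcal{Y})=\{u:\mathcal{Y}\to\mathbb{R}\mid \text{for every } y\in\mathcal{Y},\ u(y)=\min_{z\in\mathcal{Y}\setminus\{y\}}\{d(y,z)+u(z)\}\}$. *)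

theory Defs
  imports "HOL-Analysis.Analysis" "HOL-Probability.Probability"
begin

definition curve_length :: "(real \<Rightarrow> 'a::metric_space) \<Rightarrow> real \<Rightarrow> real \<Rightarrow> ennreal" where
  "curve_length g a b =
     (SUP (n, t) \<in> {(n, t). t 0 = a \<and> t n = b \<and> (\<forall>i<n. t i \<le> t (Suc i))}.
        ennreal (\<Sum>i<n. dist (g (t i)) (g (t (Suc i)))))"

definition length_space :: "'a::metric_space itself \<Rightarrow> bool" where
  "length_space _ \<longleftrightarrow>
     (\<forall>x y::'a. ennreal (dist x y) =
        (INF g \<in> {g. continuous_on {0..1} g \<and> g 0 = x \<and> g 1 = y}. curve_length g 0 1))"

definition Pp :: "real \<Rightarrow> 'a::metric_space measure set" where
  "Pp p = {\<mu>. prob_space \<mu> \<and> sets \<mu> = sets borel \<and>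
              (\<exists>x0. (\<integral>\<^sup>+ x. ennreal (dist x0 x powr p) \<partial>\<mu>) < \<infinity>)}"

definition couplings :: "'a::metric_space measure \<Rightarrow> 'a measure \<Rightarrow> ('a \<times> 'a) measure set" where
  "couplings \<mu> \<nu> = {\<pi>. prob_space \<pi> \<and> sets \<pi> = sets borel \<and>
                       distr \<pi> borel fst = \<mu> \<and> distr \<pi> borel snd = \<nu>}"

definition Wp :: "real \<Rightarrow> 'a::metric_space measure \<Rightarrow> 'a measure \<Rightarrow> real" where
  "Wp p \<mu> \<nu> = (enn2real (INF \<pi> \<in> couplings \<mu> \<nu>.
                 \<integral>\<^sup>+ xy. ennreal (dist (fst xy) (snd xy) powr p) \<partial>\<pi>)) powr (1 / p)"

text \<open>A unit-speed ray in P_p (continuity follows from the distance identity).\<close>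
definition unit_speed_ray :: "real \<Rightarrow> (real \<Rightarrow> 'a::metric_space measure) \<Rightarrow> bool" where
  "unit_speed_ray p \<mu> \<longleftrightarrow>
     (\<forall>t\<ge>0. \<mu> t \<in> Pp p) \<and>
     (\<forall>s\<ge>0. \<forall>t\<ge>0. Wp p (\<mu> s) (\<mu> t) = \<bar>s - t\<bar> * Wp p (\<mu> 0) (\<mu> 1)) \<and>
     Wp p (\<mu> 0) (\<mu> 1) = 1"

definition busemann :: "real \<Rightarrow> (real \<Rightarrow> 'a::metric_space measure) \<Rightarrow> 'a measure \<Rightarrow> real" where
  "busemann p \<mu> la = Lim at_top (\<lambda>t. Wp p la (\<mu> t) - t)"

definition metric_viscosity :: "'b set \<Rightarrow> ('b \<Rightarrow> 'b \<Rightarrow> real) \<Rightarrow> ('b \<Rightarrow> real) \<Rightarrow> bool" where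
  "metric_viscosity S d u \<longleftrightarrow>
     (\<forall>y\<in>S. \<exists>z\<in>S - {y}. u y = d y z + u z \<and> (\<forall>z'\<in>S - {y}. d y z + u z \<le> d y z' + u z'))"

end

theory Submission
  imports Defs
begin

text \<open>Follow, for a fixed \<open>\<nu>\<close>, an almost optimal transport from \<open>\<nu>\<close> to \<open>\<mu> t\<close> up to distance 1 from
  \<open>\<nu>\<close>. If the resulting measures subconverge in \<open>Wp p\<close> as \<open>t \<rightarrow> \<infinity>\<close>, the limit \<open>l\<close> satisfies
  \<open>Wp p \<nu> l \<le> 1\<close> and \<open>busemann p \<mu> l \<le> busemann p \<mu> \<nu> - 1\<close>; since Busemann functions are
  1-Lipschitz, both are equalities and \<open>l\<close> attains the minimum at \<open>\<nu>\<close>.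

  Closed balls are compact by Hopf-Rinow, so weak compactness is automatic and the point is that no
  \<open>p\<close>-th moment escapes, i.e. that \<open>(dist x0 / t) ^ p\<close> is uniformly integrable under \<open>\<mu> t\<close>. For \<open>s < t\<close>
  an almost optimal coupling of \<open>\<mu> s\<close> and \<open>\<mu> t\<close> makes Minkowski's inequality for
  \<open>dist x0 y_t \<le> dist x0 y_s + dist y_s y_t\<close> an equality up to an additive constant. As \<open>p > 1\<close>,
  \<open>dist x0 y_t / t\<close> is then controlled by \<open>dist x0 y_s / s\<close>, whose law does not depend on \<open>t\<close>.

  All couplings are only almost optimal, and gluing is only approximate (along a countable
  partition into small sets), so neither disintegration nor the existence of optimal plans is
  needed.\<close>

section \<open>Interpolation and compactness of balls in length spaces\<close>

text \<open>An interpolant sends a pair \<open>(x, y)\<close> to a point at distance about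
  \<open>dist x y / T\<close> from \<open>x\<close>, where \<open>T = Wp p \<nu> (\<mu> t)\<close>
  is comparable to \<open>t\<close>. Its distance from \<open>x0\<close> is thus controlled by
  \<open>dist x0 x\<close> and \<open>dist x0 y / t\<close>, which is why the tails of the rescaled
  distance under \<open>\<mu> t\<close> decide compactness. These tails are studied through
  \<open>t h \<le> s a + (t - s) b\<close> with \<open>a = dist x0 y_s / s\<close>,
  \<open>h = dist x0 y_t / t\<close> and \<open>b = dist y_s y_t / (t - s)\<close>. After
  integrating p-th powers the terms of order \<open>t\<close> cancel; the error left over is small
  relative to \<open>s\<close>, uniformly in \<open>t\<close>, whereas mass of \<open>h\<close>
  escaping to infinity would contribute a positive multiple of \<open>s\<close>. One large
  \<open>s\<close> therefore settles all large \<open>t\<close>. For exponent 1 the power is not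
  strictly convex and there is no such gain. Weak compactness is moved to the real line by a Borel
  injection whose convergent values force the points to converge. A Skorohod representation there
  puts the measures on one probability space, and \<open>Wp\<close> convergence becomes convergence
  in L^p of random points.\<close>

lemma length_space_interpolate:
  fixes x y :: "'a::metric_space"
  assumes "length_space TYPE('a)" "0 \<le> \<theta>" "\<theta> \<le> 1" "0 < e"
  obtains w where "dist x w = \<theta> * dist x y" "dist w y \<le> (1 - \<theta>) * dist x y + e"
proof -
  let ?C = "{g. continuous_on {0..1} g \<and> g 0 = x \<and> g 1 = y}"
  have "(INF g \<in> ?C. curve_length g 0 1) = ennreal (dist x y)"
    using assms(1) by (simp add: length_space_def)
  also have "\<dots> < ennreal (dist x y + e)"
    using assms(4) by (simp add: ennreal_less_iff)
  finally obtain g where g: "continuous_on {0..1} g" "g 0 = x" "g 1 = y"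
    and len: "curve_length g 0 1 < ennreal (dist x y + e)"
    by (auto simp: INF_less_iff)
  \<comment> \<open>The first distance is matched exactly by continuity along an almost shortest
    curve, so the whole excess \<open>e\<close> falls on the second piece.\<close>
  have "\<exists>s\<ge>0. s \<le> 1 \<and> dist x (g s) = \<theta> * dist x y"
  proof (rule IVT')
    show "dist x (g 0) \<le> \<theta> * dist x y" "\<theta> * dist x y \<le> dist x (g 1)"
      using g assms(2,3) by (auto simp: mult_left_le_one_le)
    show "continuous_on {0..1} (\<lambda>s. dist x (g s))"
      by (intro continuous_intros g)
  qed simp
  then obtain s where s: "0 \<le> s" "s \<le> 1" "dist x (g s) = \<theta> * dist x y" by blast
  define t :: "nat \<Rightarrow> real" where "t i = (if i = 0 then 0 else if i = 1 then s else 1)" for i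
  have "ennreal (dist x (g s) + dist (g s) y) = ennreal (\<Sum>i<2. dist (g (t i)) (g (t (Suc i))))"
    by (simp add: t_def eval_nat_numeral g)
  also have "\<dots> \<le> curve_length g 0 1"
    unfolding curve_length_def
    by (rule SUP_upper2[of "(2, t)"]) (use s in \<open>auto simp: t_def\<close>)
  finally have "ennreal (dist x (g s) + dist (g s) y) < ennreal (dist x y + e)"
    using len by simp
  then have "dist x (g s) + dist (g s) y < dist x y + e"
    by (simp add: ennreal_less_iff del: ennreal_plus)
  then show ?thesis
    using s(3) by (intro that[of "g s"]) (auto simp: algebra_simps)
qed

text \<open>Walk the fraction \<open>r / dist x y\<close> of the way from \<open>x\<close> to
  \<open>y\<close>. The interpolation error \<open>d\<close> is half of the available margin, so
  that the last inequality stays strict.\<close>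

lemma cball_subset_thickened:
  fixes x y :: "'a::metric_space"
  assumes "length_space TYPE('a)" "0 \<le> r" "dist x y < r + e" "0 < e"
  obtains w where "dist x w \<le> r" "dist w y < e"
proof (cases "dist x y \<le> r")
  case True
  then show ?thesis using assms that[of y] by auto
next
  case False
  then have pos: "dist x y > r" "dist x y > 0" using assms(2) by auto
  define d where "d = (r + e - dist x y) / 2"
  have d: "d > 0" using assms by (simp add: d_def)
  obtain w where w: "dist x w = (r / dist x y) * dist x y"
    "dist w y \<le> (1 - r / dist x y) * dist x y + d"
    using length_space_interpolate[OF assms(1), of "r / dist x y" d x y] pos assms(2) d
    by (auto simp: field_simps)
  have "dist w y \<le> dist x y - r + d" using w(2) pos by (simp add: field_simps)
  then have "dist w y < e" using d unfolding d_def by (simp add: field_simps)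
  moreover have "dist x w \<le> r" using w(1) pos by simp
  ultimately show ?thesis using that by blast
qed

text \<open>Supremum argument on the radii with compact ball. If the supremum \<open>R\<close> were
  finite, the ball of radius \<open>R\<close> would be complete and, lying close to compact balls of
  nearly the same radius, totally bounded. Local compactness then pushes compactness beyond
  \<open>R\<close>.\<close>

lemma Hopf_Rinow_compact_cball:
  fixes x :: "'a::metric_space"
  assumes len: "length_space TYPE('a)" and compl: "Topological_Spaces.complete (UNIV :: 'a set)"
    and loc: "locally_compact_space (euclidean :: 'a topology)"
  shows "compact (cball x r)"
proof -
  let ?S = "{r. 0 \<le> r \<and> compact (cball x r)}"
  have down: "compact (cball x r)" if "s \<in> ?S" "r \<le> s" for r s
  proof -
    have "cball x r = cball x s \<inter> cball x r" using that by (auto simp: subset_cball)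
    also have "compact \<dots>" using that by (intro compact_Int_closed) auto
    finally show ?thesis .
  qed
  have z: "0 \<in> ?S" by simp
  have "\<not> bdd_above ?S"
  proof
    assume bdd: "bdd_above ?S"
    define R where "R = Sup ?S"
    have R: "0 \<le> R" unfolding R_def using cSup_upper[OF z bdd] .
    have cR: "compact (cball x R)"
      unfolding compact_eq_totally_bounded
    proof (intro conjI allI impI)
      show "Topological_Spaces.complete (cball x R)"
        using complete_Int_closed[OF compl, of "cball x R"] by simp
      fix e :: real assume e: "0 < e"
      have "\<exists>s\<in>?S. R - e / 2 < s"
        unfolding less_cSup_iff[OF _ bdd, symmetric, OF ex_in_conv[THEN iffD1, OF exI, OF z]] R_def using e by linarith
      then obtain s where s: "s \<in> ?S" "R - e / 2 < s" by blast
      obtain k where k: "finite k" "cball x s \<subseteq> (\<Union>y\<in>k. ball y (e / 2))"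
        using compact_eq_totally_bounded[of "cball x s"] s(1) half_gt_zero[OF e] by blast
      have "cball x R \<subseteq> (\<Union>y\<in>k. ball y e)"
      proof
        fix y assume "y \<in> cball x R"
        then have "dist x y < s + e / 2" using s(2) by auto
        then obtain w where w: "dist x w \<le> s" "dist w y < e / 2"
          using cball_subset_thickened[OF len, of s x y "e / 2"] s e by auto
        then obtain v where "v \<in> k" "dist v w < e / 2" using k by auto
        then show "y \<in> (\<Union>y\<in>k. ball y e)"
          using w(2) dist_triangle_half_r[of w v e y] by (auto simp: dist_commute)
      qed
      then show "\<exists>k. finite k \<and> cball x R \<subseteq> (\<Union>y\<in>k. ball y e)" using k(1) by blast
    qed
    have "\<forall>y::'a. \<exists>U K. open U \<and> compact K \<and> y \<in> U \<and> U \<subseteq> K"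
      using loc by (auto simp: locally_compact_space_def)
    then obtain U K where UK: "\<And>y::'a. open (U y) \<and> compact (K y) \<and> y \<in> U y \<and> U y \<subseteq> K y"
      by metis
    obtain T where T: "finite T" "cball x R \<subseteq> (\<Union>y\<in>T. U y)"
      by (rule compactE_image[OF cR, of "cball x R" U]) (use UK in auto)
    let ?V = "\<Union>y\<in>T. U y"
    \<comment> \<open>A Lebesgue number of the cover; half of it can be added to the radius.\<close>
    obtain e where e: "0 < e" "\<And>y. y \<in> cball x R \<Longrightarrow> \<exists>G\<in>{?V}. ball y e \<subseteq> G"
      by (rule Heine_Borel_lemma[OF cR, of "{?V}"]) (use T UK in auto)
    have sub: "cball x (R + e / 2) \<subseteq> (\<Union>y\<in>T. K y)"
    proof
      fix y assume "y \<in> cball x (R + e / 2)"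
      then have "dist x y < R + e" using e by auto
      then obtain w where w: "dist x w \<le> R" "dist w y < e"
        using cball_subset_thickened[OF len R, of x y e] e by auto
      then have "y \<in> ?V" using e(2)[of w] by auto
      then show "y \<in> (\<Union>y\<in>T. K y)" using UK by blast
    qed
    have "compact (\<Union>y\<in>T. K y)" using T UK by (intro compact_UN) auto
    then have "compact ((\<Union>y\<in>T. K y) \<inter> cball x (R + e / 2))" by (intro compact_Int_closed) auto
    moreover have "(\<Union>y\<in>T. K y) \<inter> cball x (R + e / 2) = cball x (R + e / 2)" using sub by blast
    ultimately have "R + e / 2 \<in> ?S" using R e by auto
    then have "R + e / 2 \<le> R" unfolding R_def using cSup_upper[OF _ bdd] by blast
    then show False using e by simp
  qed
  then have "\<exists>s\<in>?S. \<not> s \<le> r"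
    unfolding bdd_above_def by blast
  then obtain s where "s \<in> ?S" "r \<le> s" by fastforce
  then show ?thesis using down by blast
qed

section \<open>Convexity inequalities and gluing of couplings\<close>

text \<open>The graph of the \<open>p\<close>-th power lies above its tangent at \<open>h\<close>.
  This is Young's inequality with conjugate exponent \<open>p / (p - 1)\<close> for the factors
  \<open>a\<close> and \<open>h powr (p - 1)\<close>.\<close>

lemma young_powr:
  fixes a h p :: real
  assumes "p > 1" "0 \<le> a" "0 \<le> h"
  shows "p * (a * h powr (p - 1)) \<le> a powr p + (p - 1) * h powr p"
proof -
  define q where "q = p / (p - 1)"
  have q: "q > 1" "1 / p + 1 / q = 1" using assms(1) by (auto simp: q_def field_simps)
  have "a * h powr (p - 1) \<le> a powr p / p + (h powr (p - 1)) powr q / q"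
    using Youngs_inequality[of p q a "h powr (p - 1)"] assms q by simp
  also have "(h powr (p - 1)) powr q = h powr p"
    using assms(1) by (simp add: powr_powr q_def)
  finally show ?thesis using assms(1) by (simp add: q_def field_simps)
qed

text \<open>Convexity of the \<open>p\<close>-th power at \<open>a / A\<close> and
  \<open>b / B\<close> with weights proportional to \<open>A\<close> and \<open>B\<close>, from the
  tangent at the mean \<open>h\<close>. With these weights, integrals \<open>A powr p\<close> and
  \<open>B powr p\<close> turn the right side into \<open>(A + B) powr p\<close>.\<close>

lemma powr_add_weighted_le:
  fixes a b A B p :: real
  assumes "p > 1" "0 \<le> a" "0 \<le> b" "0 < A" "0 < B"
  shows "(a + b) powr p \<le> (A + B) powr (p - 1) * (a powr p / A powr (p - 1) + b powr p / B powr (p - 1))"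
proof -
  define h where "h = (a + b) / (A + B)"
  have h: "0 \<le> h" using assms by (simp add: h_def)
  have "p * (a / A * h powr (p - 1)) \<le> (a / A) powr p + (p - 1) * h powr p"
    using assms h by (intro young_powr) auto
  then have 1: "p * (a * h powr (p - 1)) \<le> A * (a / A) powr p + (p - 1) * A * h powr p"
    using assms(4) by (simp add: field_simps)
  have "p * (b / B * h powr (p - 1)) \<le> (b / B) powr p + (p - 1) * h powr p"
    using assms h by (intro young_powr) auto
  then have 2: "p * (b * h powr (p - 1)) \<le> B * (b / B) powr p + (p - 1) * B * h powr p"
    using assms(5) by (simp add: field_simps)
  have 3: "h powr p = h * h powr (p - 1)"
    using h assms(1) by (cases "h = 0") (auto simp: powr_mult_base)
  have "a + b = h * (A + B)" using assms by (simp add: h_def)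
  then have "p * (a * h powr (p - 1)) + p * (b * h powr (p - 1)) = p * (A + B) * h powr p"
    unfolding 3 by (metis (no_types, lifting) distrib_left distrib_right mult.assoc mult.commute)
  then have "(A + B) * h powr p \<le> A * (a / A) powr p + B * (b / B) powr p"
    using 1 2 by (simp add: algebra_simps)
  also have "A * (a / A) powr p = a powr p / A powr (p - 1)"
    using assms by (simp add: powr_divide powr_diff)
  also have "B * (b / B) powr p = b powr p / B powr (p - 1)"
    using assms by (simp add: powr_divide powr_diff)
  also have "(A + B) * h powr p = (a + b) powr p / (A + B) powr (p - 1)"
    using assms by (simp add: powr_divide powr_diff h_def)
  finally show ?thesis
    using assms by (simp add: field_simps)
qed

lemma powr_add_le:
  fixes a b p :: real
  assumes "p > 1" "0 \<le> a" "0 \<le> b"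
  shows "(a + b) powr p \<le> 2 powr p * (a powr p + b powr p)"
proof -
  have "(a + b) powr p \<le> (2 * max a b) powr p"
    using assms by (intro powr_mono2) auto
  also have "\<dots> = 2 powr p * max a b powr p" using assms by (simp add: powr_mult)
  also have "\<dots> \<le> 2 powr p * (a powr p + b powr p)"
    by (intro mult_left_mono) (auto simp: max_def)
  finally show ?thesis .
qed

lemma powr_add3_le:
  fixes a b c p :: real
  assumes "p > 1" "0 \<le> a" "0 \<le> b" "0 \<le> c"
  shows "(a + b + c) powr p \<le> 3 powr p * (a powr p + b powr p + c powr p)"
proof -
  have "(a + b + c) powr p \<le> (3 * max a (max b c)) powr p"
    using assms by (intro powr_mono2) auto
  also have "\<dots> = 3 powr p * max a (max b c) powr p" using assms by (simp add: powr_mult)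
  also have "\<dots> \<le> 3 powr p * (a powr p + b powr p + c powr p)"
    by (intro mult_left_mono) (auto simp: max_def)
  finally show ?thesis .
qed

text \<open>Positive upper bounds \<open>A\<close> and \<open>B\<close> stand in for the norms,
  which avoids roots of extended reals and a separate case of vanishing norms.\<close>

lemma Minkowski_nn_integral:
  fixes f g :: "'b \<Rightarrow> real"
  assumes p: "p > 1"
    and f[measurable]: "f \<in> borel_measurable M" and g[measurable]: "g \<in> borel_measurable M"
    and nonneg: "\<And>x. 0 \<le> f x" "\<And>x. 0 \<le> g x"
    and A: "0 < A" "(\<integral>\<^sup>+x. ennreal (f x powr p) \<partial>M) \<le> ennreal (A powr p)"
    and B: "0 < B" "(\<integral>\<^sup>+x. ennreal (g x powr p) \<partial>M) \<le> ennreal (B powr p)"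
  shows "(\<integral>\<^sup>+x. ennreal ((f x + g x) powr p) \<partial>M) \<le> ennreal ((A + B) powr p)"
proof -
  define a where "a = (A + B) powr (p - 1) / A powr (p - 1)"
  define b where "b = (A + B) powr (p - 1) / B powr (p - 1)"
  have pos: "0 \<le> a" "0 \<le> b" by (auto simp: a_def b_def)
  have "(\<integral>\<^sup>+x. ennreal ((f x + g x) powr p) \<partial>M)
      \<le> (\<integral>\<^sup>+x. ennreal a * ennreal (f x powr p) + ennreal b * ennreal (g x powr p) \<partial>M)"
  proof (intro nn_integral_mono)
    fix x
    have "(f x + g x) powr p \<le> a * (f x powr p) + b * (g x powr p)"
      using powr_add_weighted_le[OF p nonneg(1)[of x] nonneg(2)[of x] A(1) B(1)]
      by (simp add: a_def b_def algebra_simps)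
    then show "ennreal ((f x + g x) powr p) \<le> ennreal a * ennreal (f x powr p) + ennreal b * ennreal (g x powr p)"
      using pos by (simp add: ennreal_mult'[symmetric] ennreal_plus[symmetric] ennreal_leI del: ennreal_plus)
  qed
  also have "\<dots> = ennreal a * (\<integral>\<^sup>+x. ennreal (f x powr p) \<partial>M) + ennreal b * (\<integral>\<^sup>+x. ennreal (g x powr p) \<partial>M)"
    by (simp add: nn_integral_add nn_integral_cmult)
  also have "\<dots> \<le> ennreal a * ennreal (A powr p) + ennreal b * ennreal (B powr p)"
    by (intro add_mono mult_left_mono A B) auto
  also have "\<dots> = ennreal (a * A powr p + b * B powr p)"
    using pos by (simp add: ennreal_mult'[symmetric])
  also have "a * A powr p + b * B powr p = (A + B) powr p"
  proof -
    have "a * A powr p = (A + B) powr (p - 1) * A" "b * B powr p = (A + B) powr (p - 1) * B"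
      using A B by (auto simp: a_def b_def powr_diff)
    then have "a * A powr p + b * B powr p = (A + B) powr (p - 1) * (A + B)"
      by (simp add: algebra_simps)
    also have "\<dots> = (A + B) powr p" using A B by (simp add: powr_diff)
    finally show ?thesis .
  qed
  finally show ?thesis .
qed

text \<open>Given the common code, the two points are drawn independently: the density is
  \<open>1 / m k\<close> on the rectangle where both codes equal \<open>k\<close>, whose product
  mass is the square of \<open>m k\<close>. With codes that index small cells, this glues couplings
  up to the cell diameter.\<close>

lemma coupling_with_equal_codes:
  fixes i :: "'b \<Rightarrow> nat" and j :: "'c \<Rightarrow> nat"
  assumes "prob_space P" "prob_space Q"
    and i[measurable]: "i \<in> P \<rightarrow>\<^sub>M count_space UNIV" and j[measurable]: "j \<in> Q \<rightarrow>\<^sub>M count_space UNIV"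
    and law: "distr P (count_space UNIV) i = distr Q (count_space UNIV) j"
  obtains \<rho> where "prob_space \<rho>" "sets \<rho> = sets (P \<Otimes>\<^sub>M Q)"
    "distr \<rho> P fst = P" "distr \<rho> Q snd = Q" "AE w in \<rho>. i (fst w) = j (snd w)"
proof -
  interpret P: prob_space P by fact
  interpret Q: prob_space Q by fact
  interpret PQ: pair_sigma_finite P Q ..
  define m where "m k = emeasure P (i -` {k} \<inter> space P)" for k
  have m': "m k = emeasure Q (j -` {k} \<inter> space Q)" for k
    unfolding m_def
    using arg_cong[OF law, of "\<lambda>N. emeasure N {k}"] by (simp add: emeasure_distr)
  have mfin: "m k \<noteq> \<infinity>" for k by (simp add: m_def P.emeasure_eq_measure)
  define f where "f w = (if i (fst w) = j (snd w) then inverse (m (i (fst w))) else 0)" for w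
  have [measurable]: "(\<lambda>x. inverse (m (i x))) \<in> borel_measurable P"
    by (rule measurable_compose[OF i]) simp
  \<comment> \<open>Equality of codes is measurable as a countable union over the common
    value.\<close>
  have "Measurable.pred (P \<Otimes>\<^sub>M Q) (\<lambda>w. \<exists>k. i (fst w) = k \<and> j (snd w) = k)"
    by measurable
  then have [measurable]: "Measurable.pred (P \<Otimes>\<^sub>M Q) (\<lambda>w. i (fst w) = j (snd w))"
    by (simp add: eq_commute)
  have f[measurable]: "f \<in> borel_measurable (P \<Otimes>\<^sub>M Q)"
    unfolding f_def by measurable
  define \<rho> where "\<rho> = density (P \<Otimes>\<^sub>M Q) f"
  \<comment> \<open>Codes of mass zero, where the inverse is infinite, occur with probability
    zero.\<close>
  have P0: "AE x in P. m (i x) \<noteq> 0"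
  proof -
    have "AE x in P. \<forall>k. i x = k \<longrightarrow> m k \<noteq> 0"
    proof (subst AE_all_countable, intro allI)
      fix k
      show "AE x in P. i x = k \<longrightarrow> m k \<noteq> 0"
      proof (cases "m k = 0")
        case True
        then show ?thesis by (intro AE_I'[of "i -` {k} \<inter> space P"]) (auto simp: m_def null_sets_def)
      qed auto
    qed
    then show ?thesis by auto
  qed
  have Q0: "AE y in Q. m (j y) \<noteq> 0"
  proof -
    have "AE x in Q. \<forall>k. j x = k \<longrightarrow> m k \<noteq> 0"
    proof (subst AE_all_countable, intro allI)
      fix k
      show "AE x in Q. j x = k \<longrightarrow> m k \<noteq> 0"
      proof (cases "m k = 0")
        case True
        then show ?thesis by (intro AE_I'[of "j -` {k} \<inter> space Q"]) (auto simp: m' null_sets_def)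
      qed auto
    qed
    then show ?thesis by auto
  qed
  have fQ: "(\<integral>\<^sup>+y. f (x, y) \<partial>Q) = 1" if "m (i x) \<noteq> 0" for x
  proof -
    have "(\<integral>\<^sup>+y. f (x, y) \<partial>Q) = (\<integral>\<^sup>+y. inverse (m (i x)) * indicator (j -` {i x} \<inter> space Q) y \<partial>Q)"
      by (intro nn_integral_cong) (auto simp: f_def split: split_indicator)
    also have "\<dots> = inverse (m (i x)) * m (i x)"
      by (simp add: nn_integral_cmult_indicator m')
    also have "\<dots> = 1" using that mfin[of "i x"] ennreal_divide_self[of "m (i x)"]
      by (simp add: mult.commute less_top divide_ennreal_def)
    finally show ?thesis .
  qed
  have fP: "(\<integral>\<^sup>+x. f (x, y) \<partial>P) = 1" if "m (j y) \<noteq> 0" for y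
  proof -
    have "(\<integral>\<^sup>+x. f (x, y) \<partial>P) = (\<integral>\<^sup>+x. inverse (m (j y)) * indicator (i -` {j y} \<inter> space P) x \<partial>P)"
      by (intro nn_integral_cong) (auto simp: f_def split: split_indicator)
    also have "\<dots> = inverse (m (j y)) * m (j y)"
      by (simp add: nn_integral_cmult_indicator m_def)
    also have "\<dots> = 1" using that mfin[of "j y"] ennreal_divide_self[of "m (j y)"]
      by (simp add: mult.commute less_top divide_ennreal_def)
    finally show ?thesis .
  qed
  have d1: "distr \<rho> P fst = P"
  proof (rule measure_eqI)
    fix A assume "A \<in> sets (distr \<rho> P fst)"
    then have A[measurable]: "A \<in> sets P" by simp
    have "emeasure (distr \<rho> P fst) A = emeasure \<rho> (fst -` A \<inter> space \<rho>)"
      by (subst emeasure_distr) (auto simp: \<rho>_def)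
    also have "\<dots> = (\<integral>\<^sup>+w. f w * indicator A (fst w) \<partial>(P \<Otimes>\<^sub>M Q))"
      unfolding \<rho>_def
      by (subst emeasure_density) (auto intro!: nn_integral_cong split: split_indicator)
    also have "\<dots> = (\<integral>\<^sup>+x. \<integral>\<^sup>+y. f (x, y) * indicator A x \<partial>Q \<partial>P)"
      by (subst Q.nn_integral_fst[symmetric]) auto
    also have "\<dots> = (\<integral>\<^sup>+x. indicator A x \<partial>P)"
      using P0 by (intro nn_integral_cong_AE) (auto simp: nn_integral_multc fQ)
    finally show "emeasure (distr \<rho> P fst) A = emeasure P A" by simp
  qed simp
  have d2: "distr \<rho> Q snd = Q"
  proof (rule measure_eqI)
    fix A assume "A \<in> sets (distr \<rho> Q snd)"
    then have A[measurable]: "A \<in> sets Q" by simp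
    have "emeasure (distr \<rho> Q snd) A = emeasure \<rho> (snd -` A \<inter> space \<rho>)"
      by (subst emeasure_distr) (auto simp: \<rho>_def)
    also have "\<dots> = (\<integral>\<^sup>+w. f w * indicator A (snd w) \<partial>(P \<Otimes>\<^sub>M Q))"
      unfolding \<rho>_def
      by (subst emeasure_density) (auto intro!: nn_integral_cong split: split_indicator)
    also have "\<dots> = (\<integral>\<^sup>+y. \<integral>\<^sup>+x. f (x, y) * indicator A y \<partial>P \<partial>Q)"
      by (subst PQ.nn_integral_snd[symmetric]) auto
    also have "\<dots> = (\<integral>\<^sup>+y. indicator A y \<partial>Q)"
      using Q0 by (intro nn_integral_cong_AE) (auto simp: nn_integral_multc fP)
    finally show "emeasure (distr \<rho> Q snd) A = emeasure Q A" by simp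
  qed simp
  have "prob_space \<rho>"
  proof (rule prob_space_distrD[of fst \<rho> P])
    show "fst \<in> \<rho> \<rightarrow>\<^sub>M P" by (simp add: \<rho>_def)
    show "prob_space (distr \<rho> P fst)" by (simp add: d1 P.prob_space_axioms)
  qed
  moreover have "AE w in \<rho>. i (fst w) = j (snd w)"
    unfolding \<rho>_def by (subst AE_density) (auto simp: f_def)
  ultimately show ?thesis using d1 d2 by (intro that[of \<rho>]) (auto simp: \<rho>_def)
qed

section \<open>The Wasserstein distance on a separable space\<close>

lemma borel_measurable_dist_const [measurable]:
  "(\<lambda>x. dist (c::'a::metric_space) x) \<in> borel_measurable borel"
  by (intro borel_measurable_continuous_onI continuous_intros)

lemma borel_measurable_dist_const' [measurable]:
  "(\<lambda>x. dist x (c::'a::metric_space)) \<in> borel_measurable borel"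
  by (intro borel_measurable_continuous_onI continuous_intros)

lemma borel_measurable_dist_fst_snd [measurable]:
  "(\<lambda>w::'a::metric_space \<times> 'a. dist (fst w) (snd w)) \<in> borel_measurable borel"
  by (intro borel_measurable_continuous_onI continuous_intros)

lemma measurable_fst_borel [measurable]:
  "fst \<in> (borel :: ('a::topological_space \<times> 'b::topological_space) measure) \<rightarrow>\<^sub>M borel"
  by (intro borel_measurable_continuous_onI continuous_intros)

lemma measurable_snd_borel [measurable]:
  "snd \<in> (borel :: ('a::topological_space \<times> 'b::topological_space) measure) \<rightarrow>\<^sub>M borel"
  by (intro borel_measurable_continuous_onI continuous_intros)

lemma PpD:
  assumes "\<mu> \<in> Pp p"
  shows "prob_space \<mu>" "sets \<mu> = sets borel"
  using assms by (auto simp: Pp_def)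

lemma Pp_moment:
  fixes x0 :: "'a::metric_space"
  assumes "p > 1" "\<mu> \<in> Pp p"
  obtains A where "0 < A" "(\<integral>\<^sup>+x. ennreal (dist x0 x powr p) \<partial>\<mu>) \<le> ennreal (A powr p)"
proof -
  obtain x1 where fin: "(\<integral>\<^sup>+x. ennreal (dist x1 x powr p) \<partial>\<mu>) < \<infinity>"
    using assms(2) by (auto simp: Pp_def)
  interpret prob_space \<mu> using assms(2) by (rule PpD)
  have [measurable_cong, simp]: "sets \<mu> = sets borel" using assms(2) by (rule PpD)
  let ?c = "dist x0 x1 powr p"
  have "(\<integral>\<^sup>+x. ennreal (dist x0 x powr p) \<partial>\<mu>)
      \<le> (\<integral>\<^sup>+x. ennreal (2 powr p) * (ennreal ?c + ennreal (dist x1 x powr p)) \<partial>\<mu>)"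
  proof (intro nn_integral_mono)
    fix x
    have "dist x0 x powr p \<le> (dist x0 x1 + dist x1 x) powr p"
      using assms(1) by (intro powr_mono2 dist_triangle) auto
    also have "\<dots> \<le> 2 powr p * (?c + dist x1 x powr p)"
      using assms(1) by (intro powr_add_le) auto
    finally show "ennreal (dist x0 x powr p) \<le> ennreal (2 powr p) * (ennreal ?c + ennreal (dist x1 x powr p))"
      by (simp add: ennreal_mult'[symmetric] ennreal_plus[symmetric] ennreal_leI del: ennreal_plus)
  qed
  also have "\<dots> = ennreal (2 powr p) * (ennreal ?c + (\<integral>\<^sup>+x. ennreal (dist x1 x powr p) \<partial>\<mu>))"
    by (simp add: nn_integral_cmult nn_integral_add emeasure_space_1)
  also have "\<dots> < \<infinity>" using fin by (simp add: ennreal_mult_less_top)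
  finally have fin0: "(\<integral>\<^sup>+x. ennreal (dist x0 x powr p) \<partial>\<mu>) < \<infinity>" .
  define v where "v = enn2real (\<integral>\<^sup>+x. ennreal (dist x0 x powr p) \<partial>\<mu>)"
  have v: "(\<integral>\<^sup>+x. ennreal (dist x0 x powr p) \<partial>\<mu>) = ennreal v" "0 \<le> v"
    using fin0 by (auto simp: v_def)
  \<comment> \<open>Adding 1 keeps the bound positive even when the moment vanishes.\<close>
  show ?thesis
  proof (rule that[of "(v + 1) powr (1 / p)"])
    show "0 < (v + 1) powr (1 / p)" using v(2) by simp
    show "(\<integral>\<^sup>+x. ennreal (dist x0 x powr p) \<partial>\<mu>) \<le> ennreal (((v + 1) powr (1 / p)) powr p)"
      using v assms(1) by (simp add: powr_powr ennreal_leI)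
  qed
qed

lemma couplingsD:
  assumes "\<pi> \<in> couplings \<mu> \<nu>"
  shows "prob_space \<pi>" "sets \<pi> = sets borel" "distr \<pi> borel fst = \<mu>" "distr \<pi> borel snd = \<nu>"
  using assms by (auto simp: couplings_def)

lemma nn_integral_coupling_fst:
  assumes "\<pi> \<in> couplings \<mu> \<nu>" "f \<in> borel_measurable borel"
  shows "(\<integral>\<^sup>+w. f (fst w) \<partial>\<pi>) = (\<integral>\<^sup>+x. f x \<partial>\<mu>)"
  unfolding couplingsD(3)[OF assms(1), symmetric]
  by (rule nn_integral_distr[symmetric])
     (use assms(2) couplingsD(2)[OF assms(1)] in \<open>auto cong: measurable_cong_sets\<close>)

lemma nn_integral_coupling_snd:
  assumes "\<pi> \<in> couplings \<mu> \<nu>" "f \<in> borel_measurable borel"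
  shows "(\<integral>\<^sup>+w. f (snd w) \<partial>\<pi>) = (\<integral>\<^sup>+x. f x \<partial>\<nu>)"
  unfolding couplingsD(4)[OF assms(1), symmetric]
  by (rule nn_integral_distr[symmetric])
     (use assms(2) couplingsD(2)[OF assms(1)] in \<open>auto cong: measurable_cong_sets\<close>)

lemma Wp_nonneg: "0 \<le> Wp p \<mu> \<nu>"
  by (simp add: Wp_def)

lemma Wp_le:
  assumes "p > 1" "\<pi> \<in> couplings \<mu> \<nu>" "0 \<le> A"
    and "(\<integral>\<^sup>+w. ennreal (dist (fst w) (snd w) powr p) \<partial>\<pi>) \<le> ennreal (A powr p)"
  shows "Wp p \<mu> \<nu> \<le> A"
proof -
  let ?I = "INF \<pi> \<in> couplings \<mu> \<nu>. \<integral>\<^sup>+w. ennreal (dist (fst w) (snd w) powr p) \<partial>\<pi>"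
  have "?I \<le> ennreal (A powr p)" by (rule INF_lower2[OF assms(2)]) fact
  then have "enn2real ?I \<le> A powr p"
    by (simp add: enn2real_leI)
  then have "Wp p \<mu> \<nu> \<le> (A powr p) powr (1 / p)"
    unfolding Wp_def using assms(1) by (intro powr_mono2) auto
  then show ?thesis using assms by (simp add: powr_powr)
qed

section \<open>Separable spaces: product Borel sets and the metric axioms for
  \<open>Wp\<close>\<close>

locale dense_sequence =
  fixes q :: "nat \<Rightarrow> 'a::metric_space"
  assumes dense: "0 < e \<Longrightarrow> \<exists>i. dist x (q i) < e"
begin

text \<open>The level sets of \<open>near e\<close> form a countable Borel partition into cells of
  diameter at most \<open>2 * e\<close>, along which couplings are glued.\<close>

definition near :: "real \<Rightarrow> 'a \<Rightarrow> nat" where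
  "near e x = (LEAST i. dist x (q i) < e)"

lemma dist_near: "0 < e \<Longrightarrow> dist x (q (near e x)) < e"
  unfolding near_def by (rule LeastI_ex[OF dense])

lemma measurable_near [measurable]: "near e \<in> borel \<rightarrow>\<^sub>M count_space UNIV"
  unfolding near_def by measurable

text \<open>An open set of the product is the union of the products of balls around points of
  \<open>q\<close> that it contains, and there are countably many of those. The type is merely
  metric, so second countability has to come from \<open>q\<close>.\<close>

lemma sets_borel_prod: "sets (borel \<Otimes>\<^sub>M borel) = sets (borel :: ('a \<times> 'a) measure)"
proof
  have "A \<times> B \<in> sets borel" if "A \<in> sets borel" "B \<in> sets borel" for A B :: "'a set"
  proof -
    have "A \<times> B = (fst -` A \<inter> space borel) \<inter> (snd -` B \<inter> space borel)" by auto
    also have "\<dots> \<in> sets borel"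
      using that by (intro sets.Int measurable_sets[of _ borel borel]) auto
    finally show ?thesis .
  qed
  then show "sets (borel \<Otimes>\<^sub>M borel) \<subseteq> sets (borel :: ('a \<times> 'a) measure)"
    unfolding sets_pair_measure by (intro sets.sigma_sets_subset') auto
next
  have "S \<in> sets (borel \<Otimes>\<^sub>M borel)" if S: "open S" for S :: "('a \<times> 'a) set"
  proof -
    let ?B = "\<lambda>(i, j, n). ball (q i) (1 / Suc n) \<times> ball (q j) (1 / Suc n)"
    let ?I = "{k :: nat \<times> nat \<times> nat. ?B k \<subseteq> S}"
    have "S \<subseteq> (\<Union>k\<in>?I. ?B k)"
    proof
      fix w assume "w \<in> S"
      then obtain U V where UV: "open U" "open V" "w \<in> U \<times> V" "U \<times> V \<subseteq> S"
        using S unfolding open_prod_def by metis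
      obtain e1 where e1: "0 < e1" "ball (fst w) e1 \<subseteq> U"
        using UV open_contains_ball by (metis mem_Times_iff)
      obtain e2 where e2: "0 < e2" "ball (snd w) e2 \<subseteq> V"
        using UV open_contains_ball by (metis mem_Times_iff)
      obtain n where n: "inverse (real (Suc n)) < min e1 e2 / 2"
        using reals_Archimedean[of "min e1 e2 / 2"] e1 e2 by auto
      have n0: "0 < 1 / real (Suc n)" by simp
      obtain i where i: "dist (fst w) (q i) < 1 / Suc n" using dense[OF n0] by blast
      obtain j where j: "dist (snd w) (q j) < 1 / Suc n" using dense[OF n0] by blast
      have "ball (q i) (1 / Suc n) \<subseteq> U"
      proof
        fix x assume "x \<in> ball (q i) (1 / Suc n)"
        then have "dist (fst w) x < 2 * (1 / Suc n)"
          using i dist_triangle[of "fst w" x "q i"] by simp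
        then have "dist (fst w) x < e1" using n by (simp add: inverse_eq_divide)
        then show "x \<in> U" using e1 by auto
      qed
      moreover have "ball (q j) (1 / Suc n) \<subseteq> V"
      proof
        fix x assume "x \<in> ball (q j) (1 / Suc n)"
        then have "dist (snd w) x < 2 * (1 / Suc n)"
          using j dist_triangle[of "snd w" x "q j"] by simp
        then have "dist (snd w) x < e2" using n by (simp add: inverse_eq_divide)
        then show "x \<in> V" using e2 by auto
      qed
      ultimately have "(i, j, n) \<in> ?I" using UV(4) by blast
      moreover have "w \<in> ?B (i, j, n)" using i j by (auto simp: mem_Times_iff dist_commute)
      ultimately show "w \<in> (\<Union>k\<in>?I. ?B k)" by blast
    qed
    then have "S = (\<Union>k\<in>?I. ?B k)" by blast
    also have "\<dots> \<in> sets (borel \<Otimes>\<^sub>M borel)"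
      by (intro sets.countable_UN'') auto
    finally show ?thesis .
  qed
  then have "sigma_sets (space (borel \<Otimes>\<^sub>M borel)) {S :: ('a \<times> 'a) set. open S}
      \<subseteq> sets (borel \<Otimes>\<^sub>M borel)"
    by (intro sets.sigma_sets_subset) auto
  moreover have "sets borel = sigma_sets UNIV {S :: ('a \<times> 'a) set. open S}"
    by (simp add: borel_def)
  ultimately show "sets (borel :: ('a \<times> 'a) measure) \<subseteq> sets (borel \<Otimes>\<^sub>M borel)"
    by (simp add: space_pair_measure)
qed

lemma measurable_Pair_borel [measurable (raw)]:
  assumes "f \<in> M \<rightarrow>\<^sub>M (borel :: 'a measure)" "g \<in> M \<rightarrow>\<^sub>M (borel :: 'a measure)"
  shows "(\<lambda>x. (f x, g x)) \<in> M \<rightarrow>\<^sub>M borel"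
  using measurable_Pair[OF assms] measurable_cong_sets[OF refl sets_borel_prod] by blast

lemma measurable_dist_borel [measurable (raw)]:
  assumes "f \<in> M \<rightarrow>\<^sub>M (borel :: 'a measure)" "g \<in> M \<rightarrow>\<^sub>M (borel :: 'a measure)"
  shows "(\<lambda>x. dist (f x) (g x)) \<in> borel_measurable M"
  using measurable_compose[OF measurable_Pair_borel[OF assms] borel_measurable_dist_fst_snd] by simp

text \<open>Upper bounds on \<open>Wp\<close> may be computed on any probability space carrying two
  variables with the right laws. Glued couplings, interpolants and Skorohod limits all enter in this
  way.\<close>

lemma Wp_le_random_variables:
  fixes X Y :: "'b \<Rightarrow> 'a"
  assumes "p > 1" "prob_space \<Omega>" and [measurable]: "X \<in> \<Omega> \<rightarrow>\<^sub>M borel" "Y \<in> \<Omega> \<rightarrow>\<^sub>M borel"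
    and "distr \<Omega> borel X = \<mu>" "distr \<Omega> borel Y = \<nu>" "0 \<le> A"
    and "(\<integral>\<^sup>+w. ennreal (dist (X w) (Y w) powr p) \<partial>\<Omega>) \<le> ennreal (A powr p)"
  shows "Wp p \<mu> \<nu> \<le> A"
proof (rule Wp_le)
  let ?\<pi> = "distr \<Omega> borel (\<lambda>w. (X w, Y w))"
  interpret prob_space \<Omega> by fact
  have "prob_space ?\<pi>" by (rule prob_space_distr) measurable
  then show "?\<pi> \<in> couplings \<mu> \<nu>"
    using assms(5,6) by (auto simp: couplings_def distr_distr comp_def)
  show "(\<integral>\<^sup>+w. ennreal (dist (fst w) (snd w) powr p) \<partial>?\<pi>) \<le> ennreal (A powr p)"
    using assms(8) by (subst nn_integral_distr) auto
qed fact+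

text \<open>The bound holds for every coupling, by passing through \<open>x0\<close>. It makes the
  transport cost finite and later bounds moments along a ray from below.\<close>

lemma couplings_cost:
  assumes p: "p > 1" and \<pi>: "\<pi> \<in> couplings \<mu> \<nu>"
    and A: "0 < A" "(\<integral>\<^sup>+x. ennreal (dist x0 x powr p) \<partial>\<mu>) \<le> ennreal (A powr p)"
    and B: "0 < B" "(\<integral>\<^sup>+x. ennreal (dist x0 x powr p) \<partial>\<nu>) \<le> ennreal (B powr p)"
  shows "(\<integral>\<^sup>+w. ennreal (dist (fst w) (snd w :: 'a) powr p) \<partial>\<pi>) \<le> ennreal ((A + B) powr p)"
proof -
  have [measurable_cong]: "sets \<pi> = sets borel" using \<pi> by (rule couplingsD)
  have "(\<integral>\<^sup>+w. ennreal (dist (fst w) (snd w) powr p) \<partial>\<pi>)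
      \<le> (\<integral>\<^sup>+w. ennreal ((dist x0 (fst w) + dist x0 (snd w)) powr p) \<partial>\<pi>)"
    using p by (intro nn_integral_mono ennreal_leI powr_mono2 dist_triangle3) auto
  also have "\<dots> \<le> ennreal ((A + B) powr p)"
    using A B
    by (intro Minkowski_nn_integral[OF p])
       (auto simp: nn_integral_coupling_fst[OF \<pi>, of "\<lambda>x. ennreal (dist x0 x powr p)"]
          nn_integral_coupling_snd[OF \<pi>, of "\<lambda>x. ennreal (dist x0 x powr p)"])
  finally show ?thesis .
qed

lemma couplings_nonempty:
  assumes "prob_space \<mu>" "sets \<mu> = sets borel" "prob_space \<nu>" "sets \<nu> = sets (borel :: 'a measure)"
  shows "\<mu> \<Otimes>\<^sub>M \<nu> \<in> couplings \<mu> \<nu>"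
proof -
  interpret M: prob_space \<mu> by fact
  interpret N: prob_space \<nu> by fact
  interpret P: pair_prob_space \<mu> \<nu> ..
  have "distr (\<mu> \<Otimes>\<^sub>M \<nu>) borel fst = distr (\<mu> \<Otimes>\<^sub>M \<nu>) \<mu> fst"
    using assms by (intro distr_cong) auto
  also have "\<dots> = \<mu>" by (rule N.distr_pair_fst)
  finally have 1: "distr (\<mu> \<Otimes>\<^sub>M \<nu>) borel fst = \<mu>" .
  have "distr (\<mu> \<Otimes>\<^sub>M \<nu>) borel snd = distr (\<mu> \<Otimes>\<^sub>M \<nu>) \<nu> snd"
    using assms by (intro distr_cong) auto
  also have "\<dots> = \<nu>"
  proof (rule measure_eqI)
    fix A assume A: "A \<in> sets (distr (\<mu> \<Otimes>\<^sub>M \<nu>) \<nu> snd)"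
    have "emeasure (distr (\<mu> \<Otimes>\<^sub>M \<nu>) \<nu> snd) A = emeasure (\<mu> \<Otimes>\<^sub>M \<nu>) (space \<mu> \<times> A)"
      using A sets.sets_into_space[of A \<nu>]
      by (auto simp: emeasure_distr space_pair_measure intro!: arg_cong[where f = "emeasure _"])
    then show "emeasure (distr (\<mu> \<Otimes>\<^sub>M \<nu>) \<nu> snd) A = emeasure \<nu> A"
      using A by (simp add: N.emeasure_pair_measure_Times M.emeasure_space_1)
  qed simp
  finally have 2: "distr (\<mu> \<Otimes>\<^sub>M \<nu>) borel snd = \<nu>" .
  have "sets (\<mu> \<Otimes>\<^sub>M \<nu>) = sets borel"
    using sets_pair_measure_cong[OF assms(2,4)] sets_borel_prod by simp
  then show ?thesis using 1 2 P.prob_space_axioms by (simp add: couplings_def)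
qed

lemma Wp_less_obtain:
  assumes p: "p > 1" and \<mu>: "\<mu> \<in> Pp p" and \<nu>: "\<nu> \<in> Pp p" and less: "Wp p \<mu> \<nu> < A"
  obtains \<pi> where "\<pi> \<in> couplings \<mu> (\<nu> :: 'a measure)"
    "(\<integral>\<^sup>+w. ennreal (dist (fst w) (snd w) powr p) \<partial>\<pi>) \<le> ennreal (A powr p)"
proof -
  let ?I = "INF \<pi> \<in> couplings \<mu> \<nu>. \<integral>\<^sup>+w. ennreal (dist (fst w) (snd w) powr p) \<partial>\<pi>"
  obtain a where a: "0 < a" "(\<integral>\<^sup>+x. ennreal (dist (q 0) x powr p) \<partial>\<mu>) \<le> ennreal (a powr p)"
    using Pp_moment[OF p \<mu>] .
  obtain b where b: "0 < b" "(\<integral>\<^sup>+x. ennreal (dist (q 0) x powr p) \<partial>\<nu>) \<le> ennreal (b powr p)"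
    using Pp_moment[OF p \<nu>] .
  have prod: "\<mu> \<Otimes>\<^sub>M \<nu> \<in> couplings \<mu> \<nu>"
    using PpD[OF \<mu>] PpD[OF \<nu>] by (intro couplings_nonempty)
  \<comment> \<open>\<open>enn2real\<close> sends infinity to 0, so \<open>less\<close> carries
    information only once the infimum is known to be finite; the product coupling shows that it
    is.\<close>
  have "?I \<le> ennreal ((a + b) powr p)"
    by (rule INF_lower2[OF prod]) (rule couplings_cost[OF p prod a b])
  then have fin: "?I < \<infinity>" by (simp add: order_le_less_trans)
  define r where "r = enn2real ?I"
  have r: "?I = ennreal r" "0 \<le> r" using fin by (auto simp: r_def)
  have "r powr (1 / p) < A" using less by (simp add: Wp_def r_def)
  then have "(r powr (1 / p)) powr p < A powr p"
    using p by (intro powr_less_mono2) auto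
  then have "r < A powr p" using p r by (simp add: powr_powr)
  then have "?I < ennreal (A powr p)" unfolding r(1) using r(2) by (simp add: ennreal_less_iff)
  then show ?thesis using that by (auto simp: INF_less_iff less_imp_le)
qed

lemma Wp_refl:
  assumes "p > 1" "\<mu> \<in> Pp p"
  shows "Wp p \<mu> (\<mu> :: 'a measure) = 0"
proof -
  have [measurable_cong]: "sets \<mu> = sets borel" using assms by (blast dest: PpD)
  have "Wp p \<mu> \<mu> \<le> 0"
    by (rule Wp_le_random_variables[of p \<mu> "\<lambda>x. x" "\<lambda>x. x"])
       (use assms PpD[OF assms(2)] in \<open>auto intro: distr_id2 sym\<close>)
  then show ?thesis using Wp_nonneg[of p \<mu> \<mu>] by simp
qed

lemma Wp_commute_le:
  assumes "p > 1" "\<mu> \<in> Pp p" "\<nu> \<in> Pp p"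
  shows "Wp p \<nu> \<mu> \<le> Wp p \<mu> (\<nu> :: 'a measure)"
proof (rule field_le_epsilon)
  fix e :: real assume "0 < e"
  then obtain \<pi> where \<pi>: "\<pi> \<in> couplings \<mu> \<nu>"
    "(\<integral>\<^sup>+w. ennreal (dist (fst w) (snd w) powr p) \<partial>\<pi>) \<le> ennreal ((Wp p \<mu> \<nu> + e) powr p)"
    using Wp_less_obtain[OF assms, of "Wp p \<mu> \<nu> + e"] by auto
  have [measurable_cong]: "sets \<pi> = sets borel" using \<pi> by (blast dest: couplingsD)
  show "Wp p \<nu> \<mu> \<le> Wp p \<mu> \<nu> + e"
    by (rule Wp_le_random_variables[of p \<pi> snd fst])
       (use assms \<pi> couplingsD[OF \<pi>(1)] \<open>0 < e\<close> Wp_nonneg[of p \<mu> \<nu>] in \<open>auto simp: dist_commute\<close>)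
qed

lemma Wp_commute:
  assumes "p > 1" "\<mu> \<in> Pp p" "\<nu> \<in> Pp p"
  shows "Wp p \<nu> \<mu> = Wp p \<mu> (\<nu> :: 'a measure)"
  using Wp_commute_le assms by (intro antisym) auto

text \<open>The two middle marginals share the law \<open>\<nu>\<close>, hence also the law of the
  cell index. The couplings can therefore be joined with both middle points in the same cell, and
  the gap of at most \<open>2 * e\<close> is absorbed by Minkowski's inequality.\<close>

lemma Wp_triangle:
  assumes p: "p > 1" and \<mu>: "\<mu> \<in> Pp p" and \<nu>: "\<nu> \<in> Pp p" and la: "la \<in> Pp p"
  shows "Wp p \<mu> la \<le> Wp p \<mu> \<nu> + Wp p \<nu> (la :: 'a measure)"
proof (rule field_le_epsilon)
  fix e' :: real assume "0 < e'"
  \<comment> \<open>One \<open>e\<close> for each almost optimal coupling and \<open>2 * e\<close>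
    for the gap between the middle points.\<close>
  define e where "e = e' / 4"
  have e: "0 < e" using \<open>0 < e'\<close> by (simp add: e_def)
  define A where "A = Wp p \<mu> \<nu> + e"
  define B where "B = Wp p \<nu> la + e"
  have AB: "0 < A" "0 < B" using e by (auto simp: A_def B_def add_nonneg_pos Wp_nonneg)
  obtain P where P: "P \<in> couplings \<mu> \<nu>"
    "(\<integral>\<^sup>+w. ennreal (dist (fst w) (snd w) powr p) \<partial>P) \<le> ennreal (A powr p)"
    using Wp_less_obtain[OF p \<mu> \<nu>, of A] e by (auto simp: A_def)
  obtain Q where Q: "Q \<in> couplings \<nu> la"
    "(\<integral>\<^sup>+w. ennreal (dist (fst w) (snd w) powr p) \<partial>Q) \<le> ennreal (B powr p)"
    using Wp_less_obtain[OF p \<nu> la, of B] e by (auto simp: B_def)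
  have [measurable_cong]: "sets P = sets borel" "sets Q = sets borel"
    using couplingsD[OF P(1)] couplingsD[OF Q(1)] by auto
  have "distr P (count_space UNIV) (\<lambda>w. near e (snd w)) = distr \<nu> (count_space UNIV) (near e)"
    by (simp add: couplingsD(4)[OF P(1), symmetric] distr_distr comp_def)
  also have "\<dots> = distr Q (count_space UNIV) (\<lambda>w. near e (fst w))"
    by (simp add: couplingsD(3)[OF Q(1), symmetric] distr_distr comp_def)
  finally obtain \<rho> where \<rho>: "prob_space \<rho>" "sets \<rho> = sets (P \<Otimes>\<^sub>M Q)"
    "distr \<rho> P fst = P" "distr \<rho> Q snd = Q"
    "AE w in \<rho>. near e (snd (fst w)) = near e (fst (snd w))"
    using coupling_with_equal_codes[OF couplingsD(1)[OF P(1)] couplingsD(1)[OF Q(1)],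
        of "\<lambda>w. near e (snd w)" "\<lambda>w. near e (fst w)"] by auto
  note [measurable_cong] = \<rho>(2)
  have [measurable]: "fst \<in> \<rho> \<rightarrow>\<^sub>M P" "snd \<in> \<rho> \<rightarrow>\<^sub>M Q" by measurable
  have f1: "(\<lambda>w. fst (fst w)) \<in> \<rho> \<rightarrow>\<^sub>M borel" and s2: "(\<lambda>w. snd (snd w)) \<in> \<rho> \<rightarrow>\<^sub>M borel"
    by measurable
  have "distr \<rho> borel (\<lambda>w. fst (fst w)) = distr (distr \<rho> P fst) borel fst"
    by (simp add: distr_distr comp_def)
  then have law1: "distr \<rho> borel (\<lambda>w. fst (fst w)) = \<mu>"
    by (simp add: \<rho> couplingsD(3)[OF P(1)])
  have "distr \<rho> borel (\<lambda>w. snd (snd w)) = distr (distr \<rho> Q snd) borel snd"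
    by (simp add: distr_distr comp_def)
  then have law2: "distr \<rho> borel (\<lambda>w. snd (snd w)) = la"
    by (simp add: \<rho> couplingsD(4)[OF Q(1)])
  let ?f = "\<lambda>w::'a \<times> 'a. ennreal (dist (fst w) (snd w) powr p)"
  have iP: "(\<integral>\<^sup>+w. ?f (fst w) \<partial>\<rho>) \<le> ennreal (A powr p)"
    using P(2) by (subst (asm) \<rho>(3)[symmetric]) (simp add: nn_integral_distr)
  have iQ: "(\<integral>\<^sup>+w. ?f (snd w) \<partial>\<rho>) \<le> ennreal (B powr p)"
    using Q(2) by (subst (asm) \<rho>(4)[symmetric]) (simp add: nn_integral_distr)
  interpret \<rho>: prob_space \<rho> by fact
  have "Wp p \<mu> la \<le> A + (B + 2 * e)"
  proof (rule Wp_le_random_variables[OF p \<rho>(1) f1 s2 law1 law2])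
    let ?d = "\<lambda>w. dist (fst (fst w)) (snd (fst w)) + (dist (fst (snd w)) (snd (snd w)) + 2 * e)"
    have "(\<integral>\<^sup>+w. ennreal (dist (fst (fst w)) (snd (snd w)) powr p) \<partial>\<rho>)
      \<le> (\<integral>\<^sup>+w. ennreal (?d w powr p) \<partial>\<rho>)"
    proof (rule nn_integral_mono_AE, use \<rho>(5) in eventually_elim)
      case (elim w)
      let ?z = "q (near e (snd (fst w)))"
      have "dist (snd (fst w)) ?z < e" by (rule dist_near[OF e])
      moreover have "dist (fst (snd w)) ?z < e" unfolding elim by (rule dist_near[OF e])
      ultimately have "dist (snd (fst w)) (fst (snd w)) \<le> 2 * e"
        using dist_triangle2[of "snd (fst w)" "fst (snd w)" ?z] by simp
      then have "dist (fst (fst w)) (snd (snd w)) \<le> ?d w"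
        using dist_triangle[of "fst (fst w)" "snd (snd w)" "snd (fst w)"]
          dist_triangle[of "snd (fst w)" "snd (snd w)" "fst (snd w)"] by simp
      then show ?case using p by (intro ennreal_leI powr_mono2) auto
    qed
    also have "\<dots> \<le> ennreal ((A + (B + 2 * e)) powr p)"
    proof (rule Minkowski_nn_integral[OF p])
      show "(\<integral>\<^sup>+w. ennreal ((dist (fst (snd w)) (snd (snd w)) + 2 * e) powr p) \<partial>\<rho>)
          \<le> ennreal ((B + 2 * e) powr p)"
        by (rule Minkowski_nn_integral[OF p])
           (use e AB iQ in \<open>auto simp: \<rho>.emeasure_space_1\<close>)
    qed (use e AB iP in auto)
    finally show "(\<integral>\<^sup>+w. ennreal (dist (fst (fst w)) (snd (snd w)) powr p) \<partial>\<rho>)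
      \<le> ennreal ((A + (B + 2 * e)) powr p)" .
  qed (use AB e in auto)
  then show "Wp p \<mu> la \<le> Wp p \<mu> \<nu> + Wp p \<nu> la + e'"
    by (simp add: A_def B_def e_def)
qed

end

section \<open>Compactness of tight sequences of measures\<close>

text \<open>Base 3 with digits 0 and 2, as for the Cantor set: unlike in base 2, values of sequences
  that differ by a given index stay a definite distance apart.\<close>

definition ternary :: "(nat \<Rightarrow> bool) \<Rightarrow> real" where
  "ternary d = (\<Sum>k. (2 / 3) * (1 / 3) ^ k * of_bool (d k))"

lemma sums_ternary_weights: "(\<lambda>k. (2 / 3) * (1 / 3 :: real) ^ k) sums 1"
  using sums_mult[OF geometric_sums[of "1 / 3 :: real"], of "2 / 3"] by simp

lemma summable_ternary: "summable (\<lambda>k. (2 / 3) * (1 / 3 :: real) ^ k * of_bool (d k))"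
  by (rule summable_comparison_test'[OF sums_summable[OF sums_ternary_weights], of 0]) auto

lemma ternary_nonneg: "0 \<le> ternary d"
  unfolding ternary_def by (intro suminf_nonneg summable_ternary) auto

lemma ternary_le_1: "ternary d \<le> 1"
  unfolding ternary_def
  by (rule sums_le[OF _ summable_sums[OF summable_ternary] sums_ternary_weights]) auto

text \<open>Digit \<open>j\<close> contributes \<open>2 / 3 ^ Suc j\<close>, and all later digits
  together can take back at most half of that.\<close>

lemma ternary_gap_aux:
  assumes "d j" "\<not> d' j" "\<And>i. i < j \<Longrightarrow> d i = d' i"
  shows "(1 / 3) ^ Suc j \<le> ternary d - ternary d'"
proof -
  define w :: "nat \<Rightarrow> real" where "w k = (2 / 3) * (1 / 3) ^ k" for k
  define c where "c k = w k * of_bool (d k) - w k * of_bool (d' k)" for k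
  have sc: "summable c"
    unfolding c_def w_def by (intro summable_diff summable_ternary)
  have "ternary d - ternary d' = suminf c"
    unfolding ternary_def c_def w_def by (intro suminf_diff summable_ternary)
  also have "\<dots> = (\<Sum>k. c (k + Suc j)) + (\<Sum>k<Suc j. c k)"
    by (rule suminf_split_initial_segment[OF sc])
  also have "(\<Sum>k<Suc j. c k) = w j"
    using assms by (simp add: c_def)
  finally have 1: "ternary d - ternary d' = (\<Sum>k. c (k + Suc j)) + w j" .
  have tail: "(\<lambda>k. - ((1 / 3) ^ Suc j * w k)) sums - ((1 / 3) ^ Suc j * 1)"
    unfolding w_def by (intro sums_minus sums_mult sums_ternary_weights)
  have "- ((1 / 3) ^ Suc j * 1) \<le> (\<Sum>k. c (k + Suc j))"
  proof (rule sums_le[OF _ tail])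
    show "(\<lambda>k. c (k + Suc j)) sums (\<Sum>k. c (k + Suc j))"
      using sc summable_iff_shift[of c "Suc j"] by (simp add: summable_sums)
    fix k
    have "0 \<le> w k" for k by (simp add: w_def)
    then have "- w (k + Suc j) \<le> c (k + Suc j)" by (simp add: c_def of_bool_def)
    also have "w (k + Suc j) = (1 / 3) ^ Suc j * w k" by (simp add: w_def power_add)
    finally show "- ((1 / 3) ^ Suc j * w k) \<le> c (k + Suc j)" .
  qed
  then show ?thesis unfolding 1 by (simp add: w_def)
qed

lemma ternary_gap:
  assumes "\<bar>ternary d - ternary d'\<bar> < (1 / 3) ^ Suc j"
  shows "d j = d' j"
proof (rule ccontr)
  assume "d j \<noteq> d' j"
  define i where "i = (LEAST i. d i \<noteq> d' i)"
  have i: "d i \<noteq> d' i" "i \<le> j"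
    using LeastI[of "\<lambda>i. d i \<noteq> d' i" j] Least_le[of "\<lambda>i. d i \<noteq> d' i" j] \<open>d j \<noteq> d' j\<close>
    unfolding i_def by blast+
  have before: "d k = d' k" if "k < i" for k
    using not_less_Least[of k "\<lambda>i. d i \<noteq> d' i"] that unfolding i_def by blast
  have "(1 / 3) ^ Suc i \<le> \<bar>ternary d - ternary d'\<bar>"
  proof (cases "d i")
    case True
    then have "(1 / 3) ^ Suc i \<le> ternary d - ternary d'"
      using i before by (intro ternary_gap_aux) auto
    then show ?thesis by linarith
  next
    case False
    then have "(1 / 3) ^ Suc i \<le> ternary d' - ternary d"
      using i before by (intro ternary_gap_aux) auto
    then show ?thesis by linarith
  qed
  moreover have "(1 / 3 :: real) ^ Suc j \<le> (1 / 3) ^ Suc i"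
    using i(2) by (intro power_decreasing) auto
  ultimately show False using assms by linarith
qed

section \<open>Borel coding of a proper space in the real line\<close>

locale proper_space = dense_sequence +
  assumes compl: "Topological_Spaces.complete (UNIV :: 'a set)"
    and compact_cball: "compact (cball (x::'a) r)"
begin

definition basic_ball :: "nat \<Rightarrow> 'a set" where
  "basic_ball k = ball (q (fst (prod_decode k))) (1 / Suc (snd (prod_decode k)))"

lemma basic_ball_encode [simp]: "basic_ball (prod_encode (i, n)) = ball (q i) (1 / Suc n)"
  by (simp add: basic_ball_def)

text \<open>The integer part confines points with convergent codes to a compact ball, on which the
  ternary digits determine the point uniformly.\<close>
definition code :: "'a \<Rightarrow> real" where
  "code x = real_of_int \<lfloor>dist (q 0) x\<rfloor> + ternary (\<lambda>k. x \<in> basic_ball k) / 2"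

text \<open>Halving the ternary part leaves gaps of length one half between the blocks belonging to
  different integer parts. Codes this close lie in the same block, and then the gap of the ternary
  expansion forces digit \<open>k\<close> to agree.\<close>

lemma code_close:
  assumes "\<bar>code x - code y\<bar> < (1 / 3) ^ Suc k / 2" "x \<in> basic_ball k"
  shows "y \<in> basic_ball k"
proof -
  have "(1 / 3 :: real) ^ Suc k \<le> 1 / 3" using power_decreasing[of 1 "Suc k" "1 / 3 :: real"] by simp
  then have "\<bar>code x - code y\<bar> < 1 / 2" using assms(1) by linarith
  moreover have "\<bar>ternary (\<lambda>k. x \<in> basic_ball k) - ternary (\<lambda>k. y \<in> basic_ball k)\<bar> \<le> 1"
    using ternary_nonneg[of "\<lambda>k. x \<in> basic_ball k"] ternary_nonneg[of "\<lambda>k. y \<in> basic_ball k"]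
      ternary_le_1[of "\<lambda>k. x \<in> basic_ball k"] ternary_le_1[of "\<lambda>k. y \<in> basic_ball k"]
    by linarith
  ultimately have "\<bar>real_of_int \<lfloor>dist (q 0) x\<rfloor> - real_of_int \<lfloor>dist (q 0) y\<rfloor>\<bar> < 1"
    unfolding code_def by linarith
  then have "\<lfloor>dist (q 0) x\<rfloor> = \<lfloor>dist (q 0) y\<rfloor>" by linarith
  then have "\<bar>ternary (\<lambda>k. x \<in> basic_ball k) - ternary (\<lambda>k. y \<in> basic_ball k)\<bar> < (1 / 3) ^ Suc k"
    using assms(1) unfolding code_def by linarith
  from ternary_gap[OF this] show ?thesis using assms(2) by simp
qed

lemma measurable_code [measurable]: "code \<in> borel_measurable borel"
proof -
  have [measurable]: "basic_ball k \<in> sets borel" for k by (simp add: basic_ball_def)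
  show ?thesis unfolding code_def ternary_def of_bool_def by measurable
qed

text \<open>The limit of the codes need not be a code itself, so the points are shown to be Cauchy.
  Bounded codes keep them in a compact ball, which makes the comparison of digits uniform.\<close>

lemma convergent_of_convergent_code:
  assumes "convergent (\<lambda>n. code (X n))"
  shows "convergent X"
proof -
  have cau: "Cauchy (\<lambda>n. code (X n))" using assms by (simp add: Cauchy_convergent_iff)
  obtain B where B: "\<And>n. \<bar>code (X n)\<bar> \<le> B"
    using Bseq_def[THEN iffD1, OF convergent_imp_Bseq[OF assms]] by auto
  have inK: "X n \<in> cball (q 0) (B + 1)" for n
    using B[of n] ternary_nonneg[of "\<lambda>k. X n \<in> basic_ball k"] unfolding code_def mem_cball by linarith
  have "Cauchy X"
  proof (rule metric_CauchyI)
    fix e :: real assume e: "0 < e"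
    obtain n where n: "inverse (real (Suc n)) < e / 2"
      using reals_Archimedean[of "e / 2"] e by auto
    have cover: "cball (q 0) (B + 1) \<subseteq> (\<Union>i\<in>UNIV. ball (q i) (1 / Suc n))"
      using dense[of "1 / Suc n"] by (auto simp: dist_commute)
    obtain I where I: "finite I" "cball (q 0) (B + 1) \<subseteq> (\<Union>i\<in>I. ball (q i) (1 / Suc n))"
      by (rule compactE_image[OF compact_cball _ cover]) auto
    \<comment> \<open>Finitely many balls of radius \<open>1 / Suc n\<close> cover the compact ball,
      so agreement of the digits up to the single index \<open>J\<close> suffices.\<close>
    define J where "J = Max ((\<lambda>i. prod_encode (i, n)) ` I)"
    obtain N where N: "\<And>m m'. N \<le> m \<Longrightarrow> N \<le> m' \<Longrightarrow> dist (code (X m)) (code (X m')) < (1 / 3) ^ Suc J / 2"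
      using metric_CauchyD[OF cau, of "(1 / 3) ^ Suc J / 2"] by auto
    have "dist (X m) (X m') < e" if m: "N \<le> m" "N \<le> m'" for m m'
    proof -
      obtain i where i: "i \<in> I" "X m \<in> ball (q i) (1 / Suc n)" using I(2) inK[of m] by auto
      have "prod_encode (i, n) \<le> J" unfolding J_def using I(1) i(1) by (intro Max_ge) auto
      then have "(1 / 3 :: real) ^ Suc J \<le> (1 / 3) ^ Suc (prod_encode (i, n))"
        by (intro power_decreasing) auto
      then have "\<bar>code (X m) - code (X m')\<bar> < (1 / 3) ^ Suc (prod_encode (i, n)) / 2"
        using N[OF m] unfolding dist_real_def by linarith
      then have "X m' \<in> ball (q i) (1 / Suc n)"
        using code_close[of "X m" "X m'" "prod_encode (i, n)"] i(2) by simp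
      then have "dist (X m) (X m') < 2 * (1 / Suc n)"
        using i(2) dist_triangle3[of "X m" "X m'" "q i"] by simp
      then show ?thesis using n by (simp add: inverse_eq_divide)
    qed
    then show "\<exists>N. \<forall>m\<ge>N. \<forall>m'\<ge>N. dist (X m) (X m') < e" by blast
  qed
  then show ?thesis using compl unfolding complete_def convergent_def by blast
qed

text \<open>A Borel left inverse of \<open>code\<close>, defined on all reals. Level
  \<open>n\<close> reads off the first ball of radius \<open>1 / Suc n\<close> that the digits
  allow, and the centres converge to the point.\<close>

lemma obtain_decoder:
  obtains D where "D \<in> borel_measurable borel" "\<And>x. D (code x) = x"
proof -
  \<comment> \<open>Closures are Borel, and by \<open>code_close\<close> they contain no code of a
    point outside the ball.\<close>
  define V where "V k = closure (code ` basic_ball k)" for k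
  have V: "code x \<in> V k \<longleftrightarrow> x \<in> basic_ball k" for x k
  proof
    assume "code x \<in> V k"
    then have "\<exists>y\<in>code ` basic_ball k. dist y (code x) < (1 / 3) ^ Suc k / 2"
      unfolding V_def by (rule closure_approachable[THEN iffD1, rule_format]) simp
    then obtain z where "z \<in> basic_ball k" "dist (code z) (code x) < (1 / 3) ^ Suc k / 2" by blast
    then show "x \<in> basic_ball k" using code_close[of z x k] by (simp add: dist_real_def)
  next
    assume "x \<in> basic_ball k"
    then show "code x \<in> V k"
      using closure_subset[of "code ` basic_ball k"] unfolding V_def by blast
  qed
  define L where "L n y = (LEAST i. y \<in> V (prod_encode (i, n)))" for n y
  have [measurable]: "V k \<in> sets borel" for k by (simp add: V_def)
  have L [measurable]: "L n \<in> borel \<rightarrow>\<^sub>M count_space UNIV" for n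
    unfolding L_def by measurable
  have near: "dist (q (L n (code x))) x < 1 / Suc n" for n x
  proof -
    obtain i where "dist x (q i) < 1 / Suc n" using dense[of "1 / Suc n" x] by auto
    then have "code x \<in> V (prod_encode (i, n))" by (simp add: V dist_commute)
    then have "code x \<in> V (prod_encode (L n (code x), n))" unfolding L_def by (rule LeastI)
    then show ?thesis by (simp add: V)
  qed
  \<comment> \<open>A Borel set that contains every code and on which the centres form a Cauchy
    sequence; elsewhere they are replaced by the default \<open>q 0\<close>.\<close>
  define G where "G = {y. \<forall>m n. dist (q (L m y)) (q (L n y)) \<le> 1 / Suc m + 1 / Suc n}"
  have qL [measurable]: "(\<lambda>y. q (L n y)) \<in> borel_measurable borel" for n
    by (rule measurable_compose[OF L]) simp
  have G [measurable]: "G \<in> sets borel"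
    unfolding G_def by measurable
  have codeG: "code x \<in> G" for x
    unfolding G_def
    using near[of _ x] by (blast intro: order_trans[OF dist_triangle2 add_mono] less_imp_le)
  define A where "A n y = (if y \<in> G then q (L n y) else q 0)" for n y
  have A [measurable]: "A n \<in> borel_measurable borel" for n
    unfolding A_def by measurable
  have conv: "convergent (\<lambda>n. A n y)" for y
  proof (cases "y \<in> G")
    case True
    have "Cauchy (\<lambda>n. A n y)"
    proof (rule metric_CauchyI)
      fix e :: real assume e: "0 < e"
      obtain N where N: "inverse (real (Suc N)) < e / 2"
        using reals_Archimedean[of "e / 2"] e by auto
      have "dist (A m y) (A n y) < e" if "N \<le> m" "N \<le> n" for m n
      proof -
        have "dist (A m y) (A n y) \<le> 1 / Suc m + 1 / Suc n"
          using True by (simp add: A_def G_def)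
        also have "\<dots> \<le> 1 / Suc N + 1 / Suc N"
          using that by (intro add_mono divide_left_mono) auto
        also have "\<dots> < e" using N by (simp add: inverse_eq_divide)
        finally show ?thesis .
      qed
      then show "\<exists>N. \<forall>m\<ge>N. \<forall>n\<ge>N. dist (A m y) (A n y) < e" by blast
    qed
    then show ?thesis using compl unfolding complete_def convergent_def by blast
  qed (simp add: A_def convergent_const)
  define D where "D y = lim (\<lambda>n. A n y)" for y
  have lim: "(\<lambda>n. A n y) \<longlonglongrightarrow> D y" for y
    unfolding D_def using conv by (simp add: convergent_LIMSEQ_iff)
  have "D \<in> borel_measurable borel"
    by (rule borel_measurable_LIMSEQ_metric[OF A lim])
  moreover have "D (code x) = x" for x
  proof -
    have "(\<lambda>n. A n (code x)) \<longlonglongrightarrow> x"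
    proof (rule tendsto_dist_iff[THEN iffD2], rule tendsto_sandwich[of "\<lambda>_. 0"])
      show "(\<lambda>n. 1 / real (Suc n)) \<longlonglongrightarrow> 0"
        using LIMSEQ_inverse_real_of_nat by (simp add: inverse_eq_divide)
      show "\<forall>\<^sub>F n in sequentially. dist (A n (code x)) x \<le> 1 / real (Suc n)"
        using near[of _ x] codeG by (auto simp: A_def less_imp_le intro!: always_eventually)
    qed auto
    then show ?thesis using lim LIMSEQ_unique by blast
  qed
  ultimately show ?thesis using that by blast
qed

text \<open>Tightness is transported to the laws of the codes, where a weakly convergent subsequence
  has a Skorohod representation, and the variables are decoded. The limit law may charge reals that
  are not codes; only the approximating variables are almost surely codes, and convergence of codes
  is enough for the decoded points to converge.\<close>

lemma Prokhorov_Skorohod: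
  fixes la :: "nat \<Rightarrow> 'a measure"
  assumes prob: "\<And>n. prob_space (la n)" and sets: "\<And>n. sets (la n) = sets borel"
    and tight: "\<And>e. 0 < e \<Longrightarrow> \<exists>R. \<forall>n. measure (la n) {x. R < dist (q 0) x} < e"
  obtains r and \<Omega> :: "real measure" and Z Zlim where
    "strict_mono (r :: nat \<Rightarrow> nat)" "prob_space \<Omega>"
    "\<And>n. Z n \<in> borel_measurable \<Omega>" "Zlim \<in> borel_measurable \<Omega>"
    "\<And>n. distr \<Omega> borel (Z n) = la (r n)"
    "\<And>\<omega>. \<omega> \<in> space \<Omega> \<Longrightarrow> (\<lambda>n. Z n \<omega>) \<longlonglongrightarrow> Zlim \<omega>"
proof -
  note [measurable_cong] = sets
  obtain D where D [measurable]: "D \<in> borel_measurable borel" and D_code: "\<And>x. D (code x) = x"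
    using obtain_decoder by blast
  define M where "M n = distr (la n) borel code" for n
  have M: "real_distribution (M n)" for n
    unfolding M_def by (intro prob_space.real_distribution_distr prob) auto
  have "\<exists>a b. a < b \<and> (\<forall>n. 1 - e < measure (M n) {a<..b})" if e: "0 < e" for e
  proof -
    obtain R where R: "\<And>n. measure (la n) {x. R < dist (q 0) x} < e" using tight[OF e] by blast
    \<comment> \<open>Codes are nonnegative and exceed the distance by at most one half. The left
      end -1 suits the half-open interval, and \<open>max R 0\<close> keeps the interval
      nonempty.\<close>
    have "1 - e < measure (M n) {-1<..max R 0 + 1}" for n
    proof -
      interpret prob_space "la n" by (rule prob)
      have sp: "space (la n) = UNIV" using sets_eq_imp_space_eq[OF sets[of n]] by simp
      have "1 - measure (la n) {x. R < dist (q 0) x} = measure (la n) (space (la n) - {x. R < dist (q 0) x})"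
        by (rule prob_compl[symmetric]) (auto simp: sets)
      also have "\<dots> \<le> measure (la n) (code -` {-1<..max R 0 + 1} \<inter> space (la n))"
      proof (rule finite_measure_mono)
        show "space (la n) - {x. R < dist (q 0) x} \<subseteq> code -` {-1<..max R 0 + 1} \<inter> space (la n)"
        proof
          fix x assume "x \<in> space (la n) - {x. R < dist (q 0) x}"
          then have "dist (q 0) x \<le> R" by auto
          moreover have "code x \<le> dist (q 0) x + 1"
            using ternary_le_1[of "\<lambda>k. x \<in> basic_ball k"] unfolding code_def by linarith
          moreover have "0 \<le> real_of_int \<lfloor>dist (q 0) x\<rfloor>" by simp
          then have "-1 < code x"
            using ternary_nonneg[of "\<lambda>k. x \<in> basic_ball k"] unfolding code_def by linarith
          ultimately show "x \<in> code -` {-1<..max R 0 + 1} \<inter> space (la n)" by (simp add: sp)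
        qed
      qed (intro measurable_sets[of _ _ borel]; simp)
      also have "\<dots> = measure (M n) {-1<..max R 0 + 1}"
        unfolding M_def by (subst measure_distr) auto
      finally show ?thesis using R[of n] by linarith
    qed
    moreover have "-1 < max R 0 + 1" by linarith
    ultimately show ?thesis by blast
  qed
  then have "tight M" using M by (simp add: tight_def)
  from tight_imp_convergent_subsubsequence[OF this, of id]
  obtain r M' where r: "strict_mono r" and M': "real_distribution M'" and wc: "weak_conv_m (\<lambda>n. M (r n)) M'"
    by (auto simp: strict_mono_def comp_def)
  obtain \<Omega> :: "real measure" and Y Yl where
    ps: "prob_space \<Omega>" and Y [measurable]: "\<And>n. Y n \<in> borel_measurable \<Omega>"
    and law: "\<And>n. distr \<Omega> borel (Y n) = M (r n)"
    and conv: "\<And>\<omega>. \<omega> \<in> space \<Omega> \<Longrightarrow> (\<lambda>n. Y n \<omega>) \<longlonglongrightarrow> (Yl \<omega> :: real)"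
    using Skorohod[of "\<lambda>n. M (r n)" M', OF M M' wc] by blast
  \<comment> \<open>The almost sure event that all variables are genuine codes. Off it
    \<open>Z\<close> is constant, so convergence holds at every point of the space.\<close>
  define H where "H \<omega> \<longleftrightarrow> (\<forall>n. code (D (Y n \<omega>)) = Y n \<omega>)" for \<omega>
  have [measurable]: "Measurable.pred \<Omega> H" unfolding H_def by measurable
  have AE: "AE \<omega> in \<Omega>. H \<omega>"
    unfolding H_def AE_all_countable
  proof
    fix n
    have "AE y in distr (la (r n)) borel code. code (D y) = y"
      by (subst AE_distr_iff) (auto simp: D_code)
    then have "AE y in distr \<Omega> borel (Y n). code (D y) = y"
      unfolding law M_def .
    then show "AE \<omega> in \<Omega>. code (D (Y n \<omega>)) = Y n \<omega>"
      by (subst (asm) AE_distr_iff) auto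
  qed
  define Z where "Z n \<omega> = (if H \<omega> then D (Y n \<omega>) else q 0)" for n \<omega>
  have Z [measurable]: "Z n \<in> borel_measurable \<Omega>" for n unfolding Z_def by measurable
  have lawZ: "distr \<Omega> borel (Z n) = la (r n)" for n
  proof -
    have "distr \<Omega> borel (Z n) = distr \<Omega> borel (\<lambda>\<omega>. D (Y n \<omega>))"
      using AE by (intro distr_cong_AE) (auto simp: Z_def)
    also have "\<dots> = distr (distr \<Omega> borel (Y n)) borel D"
      by (simp add: distr_distr comp_def)
    also have "\<dots> = distr (la (r n)) borel (\<lambda>x. D (code x))"
      unfolding law M_def by (subst distr_distr) (auto simp: comp_def)
    also have "\<dots> = la (r n)" by (simp add: D_code distr_id2 sets)
    finally show ?thesis .
  qed
  have convZ: "(\<lambda>n. Z n \<omega>) \<longlonglongrightarrow> lim (\<lambda>n. Z n \<omega>)" if \<omega>: "\<omega> \<in> space \<Omega>" for \<omega>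
  proof -
    have "convergent (\<lambda>n. Z n \<omega>)"
    proof (cases "H \<omega>")
      case True
      then have "(\<lambda>n. code (Z n \<omega>)) = (\<lambda>n. Y n \<omega>)" by (simp add: Z_def H_def)
      then show ?thesis
        using conv[OF \<omega>] by (intro convergent_of_convergent_code) (auto simp: convergent_def)
    qed (simp add: Z_def convergent_const)
    then show ?thesis by (simp add: convergent_LIMSEQ_iff)
  qed
  show ?thesis
    by (rule that[OF r ps Z borel_measurable_LIMSEQ_metric[OF Z convZ] lawZ convZ])
qed

end

section \<open>From tightness to convergence in \<open>Wp\<close>\<close>

lemma Fatou_nn_integral_le:
  fixes f :: "nat \<Rightarrow> 'b \<Rightarrow> ennreal"
  assumes "\<And>n. f n \<in> borel_measurable M"
    and lim: "\<And>x. x \<in> space M \<Longrightarrow> (\<lambda>n. f n x) \<longlonglongrightarrow> g x"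
    and "\<forall>\<^sub>F n in sequentially. (\<integral>\<^sup>+x. f n x \<partial>M) \<le> c"
  shows "(\<integral>\<^sup>+x. g x \<partial>M) \<le> c"
proof -
  have "(\<integral>\<^sup>+x. g x \<partial>M) = (\<integral>\<^sup>+x. liminf (\<lambda>n. f n x) \<partial>M)"
    using lim by (intro nn_integral_cong lim_imp_Liminf[symmetric]) auto
  also have "\<dots> \<le> liminf (\<lambda>n. \<integral>\<^sup>+x. f n x \<partial>M)" by (rule nn_integral_liminf) fact
  also have "\<dots> \<le> c" using assms(3) by (intro Liminf_le) auto
  finally show ?thesis .
qed

context proper_space
begin

lemma tight_of_bounded_moments:
  fixes la :: "nat \<Rightarrow> 'a measure"
  assumes p: "p > 1" and prob: "\<And>n. prob_space (la n)" and sets: "\<And>n. sets (la n) = sets borel"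
    and bound: "\<And>n. (\<integral>\<^sup>+x. ennreal (dist (q 0) x powr p) \<partial>la n) \<le> ennreal C" "0 \<le> C"
    and e: "0 < e"
  shows "\<exists>R. \<forall>n. measure (la n) {x. R < dist (q 0) x} < e"
proof -
  note [measurable_cong] = sets
  \<comment> \<open>Markov's inequality at the level whose \<open>p\<close>-th power is
    \<open>v\<close>; the summand 1 makes \<open>C / v < e\<close> strict and keeps \<open>v\<close>
    positive when \<open>C\<close> is 0.\<close>
  define v where "v = (C + 1) / e"
  have v: "0 < v" using bound(2) e by (simp add: v_def)
  define R where "R = v powr (1 / p)"
  have R: "0 < R" "R powr p = v" using v p by (auto simp: R_def powr_powr)
  have "measure (la n) {x. R < dist (q 0) x} < e" for n
  proof -
    interpret prob_space "la n" by (rule prob)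
    let ?S = "{x. R < dist (q 0) x}"
    have "ennreal (v * measure (la n) ?S) = (\<integral>\<^sup>+x. ennreal v * indicator ?S x \<partial>la n)"
      using v by (simp add: nn_integral_cmult_indicator sets emeasure_eq_measure ennreal_mult)
    also have "\<dots> \<le> (\<integral>\<^sup>+x. ennreal (dist (q 0) x powr p) \<partial>la n)"
    proof (intro nn_integral_mono)
      fix x
      have "R < dist (q 0) x \<Longrightarrow> v \<le> dist (q 0) x powr p"
        using R p powr_mono2[of p R "dist (q 0) x"] by simp
      then show "ennreal v * indicator ?S x \<le> ennreal (dist (q 0) x powr p)"
        by (auto simp: ennreal_leI split: split_indicator)
    qed
    also have "\<dots> \<le> ennreal C" by (rule bound)
    finally have "v * measure (la n) ?S \<le> C" using bound(2) by simp
    then have "measure (la n) ?S \<le> C / v" using v by (simp add: field_simps)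
    also have "\<dots> < e" using e bound(2) by (simp add: v_def field_simps)
    finally show ?thesis .
  qed
  then show ?thesis by blast
qed

text \<open>Pointwise convergence of Skorohod representatives together with uniform integrability
  gives convergence in L^p. Tails are measured by the excess over \<open>R\<close>, a continuous
  function of the point, so Fatou's lemma carries the bound over to the limit.\<close>

lemma Wp_convergent_subsequence:
  fixes la :: "nat \<Rightarrow> 'a measure"
  assumes p: "p > 1" and prob: "\<And>n. prob_space (la n)" and sets: "\<And>n. sets (la n) = sets borel"
    and bound: "\<And>n. (\<integral>\<^sup>+x. ennreal (dist (q 0) x powr p) \<partial>la n) \<le> ennreal C" "0 \<le> C"
    and tail: "\<And>e. 0 < e \<Longrightarrow> \<exists>R\<ge>0. \<exists>N. \<forall>n\<ge>N.
      (\<integral>\<^sup>+x. ennreal (max 0 (dist (q 0) x - R) powr p) \<partial>la n) \<le> ennreal e"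
  obtains r l where "strict_mono (r :: nat \<Rightarrow> nat)" "l \<in> Pp p" "(\<lambda>n. Wp p (la (r n)) l) \<longlonglongrightarrow> 0"
proof -
  obtain r and \<Omega> :: "real measure" and Z Zl where
    r: "strict_mono (r :: nat \<Rightarrow> nat)" and ps: "prob_space \<Omega>" and
    Z [measurable]: "\<And>n. Z n \<in> borel_measurable \<Omega>" and Zl [measurable]: "Zl \<in> borel_measurable \<Omega>" and
    law: "\<And>n. distr \<Omega> borel (Z n) = la (r n)" and
    conv: "\<And>\<omega>. \<omega> \<in> space \<Omega> \<Longrightarrow> (\<lambda>n. Z n \<omega>) \<longlonglongrightarrow> Zl \<omega>"
  proof (rule Prokhorov_Skorohod[of la, OF prob sets tight_of_bounded_moments[OF p prob sets bound]],
      goal_cases)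
    case (2 r \<Omega> Z Zl)
    show ?case by (rule 2(1)[OF 2(2-7)])
  qed
  interpret \<Omega>: prob_space \<Omega> by fact
  define l where "l = distr \<Omega> borel Zl"
  have int: "(\<integral>\<^sup>+\<omega>. f (Z n \<omega>) \<partial>\<Omega>) = (\<integral>\<^sup>+x. f x \<partial>la (r n))" if "f \<in> borel_measurable borel" for f n
    using that by (subst law[symmetric], subst nn_integral_distr) auto
  have "(\<integral>\<^sup>+\<omega>. ennreal (dist (q 0) (Zl \<omega>) powr p) \<partial>\<Omega>) \<le> ennreal C"
  proof (rule Fatou_nn_integral_le)
    show "(\<lambda>n. ennreal (dist (q 0) (Z n \<omega>) powr p)) \<longlonglongrightarrow> ennreal (dist (q 0) (Zl \<omega>) powr p)"
      if "\<omega> \<in> space \<Omega>" for \<omega>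
      using conv[OF that] p by (intro tendsto_ennrealI tendsto_powr' tendsto_intros) auto
    show "\<forall>\<^sub>F n in sequentially. (\<integral>\<^sup>+\<omega>. ennreal (dist (q 0) (Z n \<omega>) powr p) \<partial>\<Omega>) \<le> ennreal C"
      by (simp add: int[of "\<lambda>x. ennreal (dist (q 0) x powr p)"] bound)
  qed measurable
  then have "(\<integral>\<^sup>+x. ennreal (dist (q 0) x powr p) \<partial>l) < \<infinity>"
    by (simp add: l_def nn_integral_distr order_le_less_trans)
  then have l: "l \<in> Pp p"
    unfolding Pp_def l_def by (intro CollectI conjI exI \<Omega>.prob_space_distr Zl) simp_all
  have ev: "\<forall>\<^sub>F n in sequentially. Wp p (la (r n)) l \<le> \<delta>" if \<delta>: "0 < \<delta>" for \<delta>
  proof -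
    \<comment> \<open>Three contributions of size \<open>e\<close>, multiplied by the factor of
      \<open>powr_add3_le\<close>.\<close>
    define e where "e = \<delta> powr p / (3 * 3 powr p)"
    have e: "0 < e" using \<delta> by (simp add: e_def)
    obtain R N where R: "0 \<le> R" and
      RN: "\<And>n. N \<le> n \<Longrightarrow> (\<integral>\<^sup>+x. ennreal (max 0 (dist (q 0) x - R) powr p) \<partial>la n) \<le> ennreal e"
      using tail[OF e] by blast
    let ?ex = "\<lambda>x. max 0 (dist (q 0) x - R) powr p"
    have exZ: "(\<integral>\<^sup>+\<omega>. ennreal (?ex (Z n \<omega>)) \<partial>\<Omega>) \<le> ennreal e" if "N \<le> n" for n
      using RN[of "r n"] that seq_suble[OF r, of n]
      by (simp add: int[of "\<lambda>x. ennreal (?ex x)"])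
    have exZl: "(\<integral>\<^sup>+\<omega>. ennreal (?ex (Zl \<omega>)) \<partial>\<Omega>) \<le> ennreal e"
    proof (rule Fatou_nn_integral_le)
      show "(\<lambda>n. ennreal (?ex (Z n \<omega>))) \<longlonglongrightarrow> ennreal (?ex (Zl \<omega>))"
        if "\<omega> \<in> space \<Omega>" for \<omega>
        using conv[OF that] p by (intro tendsto_ennrealI tendsto_powr' tendsto_intros) auto
      show "\<forall>\<^sub>F n in sequentially. (\<integral>\<^sup>+\<omega>. ennreal (?ex (Z n \<omega>)) \<partial>\<Omega>) \<le> ennreal e"
        using exZ by (auto simp: eventually_sequentially)
    qed measurable
    \<comment> \<open>The distance is split into this truncated part, handled by dominated
      convergence, and the excesses of its two endpoints over \<open>R\<close>.\<close>
    let ?m = "\<lambda>n \<omega>. ennreal (min (dist (Z n \<omega>) (Zl \<omega>)) (2 * R) powr p)"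
    have "(\<lambda>n. \<integral>\<^sup>+\<omega>. ?m n \<omega> \<partial>\<Omega>) \<longlonglongrightarrow> (\<integral>\<^sup>+\<omega>. 0 \<partial>\<Omega>)"
    proof (rule nn_integral_dominated_convergence[where w = "\<lambda>_. ennreal ((2 * R) powr p)"])
      show "AE \<omega> in \<Omega>. ?m n \<omega> \<le> ennreal ((2 * R) powr p)" for n
        using R p by (intro always_eventually allI ennreal_leI powr_mono2) auto
      show "AE \<omega> in \<Omega>. (\<lambda>n. ?m n \<omega>) \<longlonglongrightarrow> 0"
      proof (rule AE_I2)
        fix \<omega> assume "\<omega> \<in> space \<Omega>"
        then have "(\<lambda>n. ?m n \<omega>) \<longlonglongrightarrow> ennreal (min (dist (Zl \<omega>) (Zl \<omega>)) (2 * R) powr p)"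
          using conv[of \<omega>] p R by (intro tendsto_ennrealI tendsto_powr' tendsto_intros) auto
        then show "(\<lambda>n. ?m n \<omega>) \<longlonglongrightarrow> 0" using R p by simp
      qed
    qed (auto simp: \<Omega>.emeasure_space_1)
    then have "\<forall>\<^sub>F n in sequentially. (\<integral>\<^sup>+\<omega>. ?m n \<omega> \<partial>\<Omega>) < ennreal e"
      using e by (intro order_tendstoD(2)) auto
    then show ?thesis
      using eventually_ge_at_top[of N]
    proof eventually_elim
      case (elim n)
      show ?case
      proof (rule Wp_le_random_variables[OF p ps Z Zl law l_def[symmetric] less_imp_le[OF \<delta>]])
        have "(\<integral>\<^sup>+\<omega>. ennreal (dist (Z n \<omega>) (Zl \<omega>) powr p) \<partial>\<Omega>) \<le>
          (\<integral>\<^sup>+\<omega>. ennreal (3 powr p) * (?m n \<omega> + ennreal (?ex (Z n \<omega>)) + ennreal (?ex (Zl \<omega>))) \<partial>\<Omega>)"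
        proof (intro nn_integral_mono)
          fix \<omega>
          have "dist (Z n \<omega>) (Zl \<omega>) \<le> min (dist (Z n \<omega>) (Zl \<omega>)) (2 * R) +
              max 0 (dist (q 0) (Z n \<omega>) - R) + max 0 (dist (q 0) (Zl \<omega>) - R)"
            using dist_triangle3[of "Z n \<omega>" "Zl \<omega>" "q 0"] by (auto simp: min_def max_def)
          then have "dist (Z n \<omega>) (Zl \<omega>) powr p \<le> (min (dist (Z n \<omega>) (Zl \<omega>)) (2 * R) +
              max 0 (dist (q 0) (Z n \<omega>) - R) + max 0 (dist (q 0) (Zl \<omega>) - R)) powr p"
            using p by (intro powr_mono2) auto
          also have "\<dots> \<le> 3 powr p * (min (dist (Z n \<omega>) (Zl \<omega>)) (2 * R) powr p + ?ex (Z n \<omega>) + ?ex (Zl \<omega>))"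
            using p R by (intro powr_add3_le) auto
          finally show "ennreal (dist (Z n \<omega>) (Zl \<omega>) powr p)
              \<le> ennreal (3 powr p) * (?m n \<omega> + ennreal (?ex (Z n \<omega>)) + ennreal (?ex (Zl \<omega>)))"
            by (simp add: ennreal_mult'[symmetric] ennreal_plus[symmetric] ennreal_leI del: ennreal_plus)
        qed
        also have "\<dots> = ennreal (3 powr p) * ((\<integral>\<^sup>+\<omega>. ?m n \<omega> \<partial>\<Omega>) +
            (\<integral>\<^sup>+\<omega>. ennreal (?ex (Z n \<omega>)) \<partial>\<Omega>) + (\<integral>\<^sup>+\<omega>. ennreal (?ex (Zl \<omega>)) \<partial>\<Omega>))"
          by (subst nn_integral_cmult, measurable) (simp add: nn_integral_add)
        also have "\<dots> \<le> ennreal (3 powr p) * (ennreal e + ennreal e + ennreal e)"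
          using elim by (intro mult_left_mono add_mono exZ exZl) auto
        also have "\<dots> = ennreal (3 powr p * (e + e + e))"
          using e by (simp add: ennreal_mult'[symmetric] ennreal_plus[symmetric] del: ennreal_plus)
        also have "3 powr p * (e + e + e) = \<delta> powr p" by (simp add: e_def)
        finally show "(\<integral>\<^sup>+\<omega>. ennreal (dist (Z n \<omega>) (Zl \<omega>) powr p) \<partial>\<Omega>) \<le> ennreal (\<delta> powr p)" .
      qed
    qed
  qed
  have "(\<lambda>n. Wp p (la (r n)) l) \<longlonglongrightarrow> 0"
  proof (rule order_tendstoI)
    fix a :: real assume "0 < a"
    then have "\<forall>\<^sub>F n in sequentially. Wp p (la (r n)) l \<le> a / 2" by (intro ev) auto
    then show "\<forall>\<^sub>F n in sequentially. Wp p (la (r n)) l < a"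
      by eventually_elim (use \<open>0 < a\<close> in linarith)
  next
    fix a :: real assume "a < 0"
    then show "\<forall>\<^sub>F n in sequentially. a < Wp p (la (r n)) l"
      using order_less_le_trans[OF _ Wp_nonneg] by (intro always_eventually allI)
  qed
  then show ?thesis using that r l by blast
qed

end

section \<open>Uniform integrability along a ray\<close>

lemma nn_integral_powr_tail:
  fixes f :: "'b \<Rightarrow> real"
  assumes [measurable]: "f \<in> borel_measurable M"
    and "(\<integral>\<^sup>+x. ennreal (f x powr p) \<partial>M) < \<infinity>" "0 < e"
  shows "\<exists>R\<ge>0. (\<integral>\<^sup>+x. ennreal (f x powr p * of_bool (R < f x)) \<partial>M) \<le> ennreal e"
proof -
  have "(\<lambda>n::nat. \<integral>\<^sup>+x. ennreal (f x powr p * of_bool (real n < f x)) \<partial>M) \<longlonglongrightarrow> (\<integral>\<^sup>+x. 0 \<partial>M)"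
  proof (rule nn_integral_dominated_convergence[where w = "\<lambda>x. ennreal (f x powr p)"])
    show "AE x in M. (\<lambda>n::nat. ennreal (f x powr p * of_bool (real n < f x))) \<longlonglongrightarrow> 0"
    proof (rule AE_I2)
      fix x
      obtain N :: nat where "f x \<le> real N" using real_arch_simple by blast
      then have "\<forall>\<^sub>F n::nat in sequentially. ennreal (f x powr p * of_bool (real n < f x)) = 0"
        by (intro eventually_sequentiallyI[of N]) auto
      then show "(\<lambda>n::nat. ennreal (f x powr p * of_bool (real n < f x))) \<longlonglongrightarrow> 0"
        by (rule tendsto_eventually)
    qed
  qed (use assms in \<open>auto simp: of_bool_def intro!: AE_I2 ennreal_leI\<close>)
  then have "\<forall>\<^sub>F n::nat in sequentially. (\<integral>\<^sup>+x. ennreal (f x powr p * of_bool (real n < f x)) \<partial>M) < ennreal e"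
    using assms(3) by (intro order_tendstoD(2)) auto
  then obtain n :: nat where "(\<integral>\<^sup>+x. ennreal (f x powr p * of_bool (real n < f x)) \<partial>M) < ennreal e"
    using eventually_happens by fastforce
  then show ?thesis by (intro exI[of _ "real n"]) auto
qed

lemma excess_powr_le:
  fixes x R p :: real
  assumes "p > 1" "0 \<le> R"
  shows "max 0 (x - R) powr p \<le> x powr p * of_bool (R < x)"
  using assms by (auto intro!: powr_mono2 simp: max_def)

text \<open>Almost equality in Minkowski's inequality for the sum \<open>t h \<le> s a + (t - s) b\<close> prevents
  \<open>h\<close> from concentrating mass where \<open>a\<close> does not: the excess term on the left comes from applying
  Young's inequality to \<open>a h\<^sup>p\<^sup>-\<^sup>1\<close> with unbalanced weights on the set where \<open>h\<close> is large.\<close>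
lemma convexity_defect:
  fixes a b h s t M R p :: real
  assumes p: "p > 1" and nonneg: "0 \<le> a" "0 \<le> b" "0 \<le> h" "0 < s" "s < t" "0 \<le> M" "0 < R"
    and le: "t * h \<le> s * a + (t - s) * b"
  shows "t * h powr p + s * ((p - 1) / 2) * (h powr p * of_bool (R < h))
    \<le> s * a powr p + s * 2 powr (p - 1) * ((M / R) powr p * h powr p + a powr p * of_bool (M < a))
      + (t - s) * b powr p"
proof -
  have hp: "h powr p = h * h powr (p - 1)"
    using nonneg p by (cases "h = 0") (auto simp: powr_mult_base)
  have "p * h powr (p - 1) * (t * h) \<le> p * h powr (p - 1) * (s * a + (t - s) * b)"
    using p by (intro mult_left_mono le) auto
  then have 1: "p * (t * h powr p) \<le> s * (p * (a * h powr (p - 1))) + (t - s) * (p * (b * h powr (p - 1)))"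
    unfolding hp by (simp add: algebra_simps)
  have "(t - s) * (p * (b * h powr (p - 1))) \<le> (t - s) * (b powr p + (p - 1) * h powr p)"
    using nonneg p by (intro mult_left_mono young_powr) auto
  with 1 have 2: "p * (t * h powr p) \<le> s * (p * (a * h powr (p - 1))) + (t - s) * (b powr p + (p - 1) * h powr p)"
    by linarith
  show ?thesis
  proof (cases "R < h")
    case False
    have "s * (p * (a * h powr (p - 1))) \<le> s * (a powr p + (p - 1) * h powr p)"
      using nonneg p by (intro mult_left_mono young_powr) auto
    with 2 have "t * h powr p \<le> s * a powr p + (t - s) * b powr p" by (simp add: algebra_simps)
    moreover have "0 \<le> s * 2 powr (p - 1) * ((M / R) powr p * h powr p + a powr p * of_bool (M < a))"
      using nonneg by auto
    ultimately show ?thesis using False by simp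
  next
    case True
    \<comment> \<open>Young's inequality is applied to \<open>a / k powr (p - 1)\<close> and
      \<open>k * h\<close>. Halving the coefficient of \<open>h powr p\<close> leaves the gain
      \<open>(p - 1) / 2\<close>, at the price of the factor \<open>2 powr (p - 1)\<close> on
      \<open>a powr p\<close>.\<close>
    define k :: real where "k = (1 / 2) powr (1 / p)"
    have k: "0 < k" "k powr p = 1 / 2" using p by (auto simp: k_def powr_powr)
    have "(1 / k powr (p - 1)) powr p = 1 / (k powr p) powr (p - 1)"
      by (simp add: powr_divide powr_powr mult.commute)
    also have "\<dots> = 2 powr (p - 1)" unfolding k(2) by (simp add: powr_divide)
    finally have kk: "(1 / k powr (p - 1)) powr p = 2 powr (p - 1)" .
    have y: "p * ((a * (1 / k powr (p - 1))) * (k * h) powr (p - 1))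
        \<le> (a * (1 / k powr (p - 1))) powr p + (p - 1) * (k * h) powr p"
      using nonneg p k by (intro young_powr) auto
    have y1: "(a * (1 / k powr (p - 1))) * (k * h) powr (p - 1) = a * h powr (p - 1)"
      using nonneg k by (simp add: powr_mult)
    have y2: "(a * (1 / k powr (p - 1))) powr p = 2 powr (p - 1) * a powr p"
      using nonneg k kk by (subst powr_mult) auto
    have y3: "(k * h) powr p = h powr p / 2" using nonneg k by (simp add: powr_mult)
    have "p * (a * h powr (p - 1)) \<le> 2 powr (p - 1) * a powr p + (p - 1) * (h powr p / 2)"
      using y unfolding y1 y2 y3 .
    then have "s * (p * (a * h powr (p - 1))) \<le> s * (2 powr (p - 1) * a powr p + (p - 1) * (h powr p / 2))"
      using nonneg by (intro mult_left_mono) auto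
    with 2 have 3: "t * h powr p + s * ((p - 1) / 2) * h powr p \<le> s * 2 powr (p - 1) * a powr p + (t - s) * b powr p"
      by (simp add: algebra_simps add_divide_distrib diff_divide_distrib)
    \<comment> \<open>Where \<open>h\<close> exceeds \<open>R\<close>, either \<open>a\<close> is at
      most \<open>M\<close> and hence at most \<open>M / R * h\<close>, or \<open>a\<close> lies in
      its own tail.\<close>
    have "a powr p \<le> (M / R) powr p * h powr p + a powr p * of_bool (M < a)"
    proof (cases "M < a")
      case False
      have "a powr p \<le> (M / R * h) powr p"
      proof (intro powr_mono2)
        have "a * R \<le> M * h" using True False nonneg by (intro mult_mono) auto
        then show "a \<le> M / R * h" using nonneg by (simp add: pos_le_divide_eq)
      qed (use p nonneg in auto)
      also have "\<dots> = (M / R) powr p * h powr p" by (rule powr_mult)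
      finally show ?thesis using False by simp
    qed simp
    then have "s * 2 powr (p - 1) * a powr p
        \<le> s * 2 powr (p - 1) * ((M / R) powr p * h powr p + a powr p * of_bool (M < a))"
      using nonneg by (intro mult_left_mono) auto
    moreover have "0 \<le> s * a powr p" using nonneg by simp
    ultimately show ?thesis using 3 True by simp
  qed
qed

lemma nn_integral_le_imp_integral_le:
  fixes f :: "'b \<Rightarrow> real"
  assumes "f \<in> borel_measurable M" "\<And>x. 0 \<le> f x" "0 \<le> c"
    and "(\<integral>\<^sup>+x. ennreal (f x) \<partial>M) \<le> ennreal c"
  shows "integrable M f" "integral\<^sup>L M f \<le> c"
proof -
  show int: "integrable M f"
    using assms by (intro integrableI_nonneg) (auto simp: order_le_less_trans)
  show "integral\<^sup>L M f \<le> c"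
    using assms nn_integral_eq_integral[OF int] by simp
qed

lemma nn_integral_scaled_le:
  fixes f :: "'b \<Rightarrow> real"
  assumes [measurable]: "f \<in> borel_measurable M" and "\<And>x. 0 \<le> f x" "0 < s" "0 < A"
    and le: "(\<integral>\<^sup>+x. ennreal (f x powr p) \<partial>M) \<le> ennreal (A powr p)"
  shows "(\<integral>\<^sup>+x. ennreal ((f x / s) powr p) \<partial>M) \<le> ennreal ((A / s) powr p)"
proof -
  have "(\<integral>\<^sup>+x. ennreal ((f x / s) powr p) \<partial>M) = (\<integral>\<^sup>+x. ennreal (1 / s powr p) * ennreal (f x powr p) \<partial>M)"
    using assms by (intro nn_integral_cong) (simp add: powr_divide ennreal_mult'[symmetric])
  also have "\<dots> = ennreal (1 / s powr p) * (\<integral>\<^sup>+x. ennreal (f x powr p) \<partial>M)"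
    by (rule nn_integral_cmult) measurable
  also have "\<dots> \<le> ennreal (1 / s powr p) * ennreal (A powr p)"
    by (intro mult_left_mono le) auto
  also have "\<dots> = ennreal ((A / s) powr p)"
    using assms by (simp add: powr_divide ennreal_mult'[symmetric])
  finally show ?thesis .
qed

lemma unit_speed_rayD:
  assumes "unit_speed_ray p \<mu>"
  shows "0 \<le> t \<Longrightarrow> \<mu> t \<in> Pp p"
    and "0 \<le> s \<Longrightarrow> 0 \<le> t \<Longrightarrow> Wp p (\<mu> s) (\<mu> t) = \<bar>s - t\<bar>"
  using assms unfolding unit_speed_ray_def by auto

section \<open>Moment growth and tails along the ray\<close>

context dense_sequence
begin

lemma ray_moment_le:
  fixes \<mu> :: "real \<Rightarrow> 'a measure"
  assumes p: "p > 1" and ray: "unit_speed_ray p \<mu>" and t: "0 \<le> t"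
    and C: "0 < C" "(\<integral>\<^sup>+x. ennreal (dist (q 0) x powr p) \<partial>\<mu> 0) \<le> ennreal (C powr p)"
  shows "(\<integral>\<^sup>+x. ennreal (dist (q 0) x powr p) \<partial>\<mu> t) \<le> ennreal ((C + (t + 1)) powr p)"
proof -
  obtain \<pi> where \<pi>: "\<pi> \<in> couplings (\<mu> 0) (\<mu> t)"
    "(\<integral>\<^sup>+w. ennreal (dist (fst w) (snd w) powr p) \<partial>\<pi>) \<le> ennreal ((t + 1) powr p)"
    using Wp_less_obtain[OF p, of "\<mu> 0" "\<mu> t" "t + 1"] unit_speed_rayD[OF ray] t by auto
  have [measurable_cong]: "sets \<pi> = sets borel" using \<pi>(1) by (rule couplingsD)
  have "(\<integral>\<^sup>+x. ennreal (dist (q 0) x powr p) \<partial>\<mu> t) = (\<integral>\<^sup>+w. ennreal (dist (q 0) (snd w) powr p) \<partial>\<pi>)"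
    by (rule nn_integral_coupling_snd[OF \<pi>(1), symmetric]) measurable
  also have "\<dots> \<le> (\<integral>\<^sup>+w. ennreal ((dist (q 0) (fst w) + dist (fst w) (snd w)) powr p) \<partial>\<pi>)"
    using p by (intro nn_integral_mono ennreal_leI powr_mono2 dist_triangle) auto
  also have "\<dots> \<le> ennreal ((C + (t + 1)) powr p)"
    using C \<pi> t nn_integral_coupling_fst[OF \<pi>(1), of "\<lambda>x. ennreal (dist (q 0) x powr p)"]
    by (intro Minkowski_nn_integral[OF p]) auto
  finally show ?thesis .
qed

text \<open>The product coupling of \<open>\<mu> 0\<close> and \<open>\<mu> t\<close> costs at most
  the sum of the two norms of the distance to \<open>q 0\<close>, while the ray forces
  \<open>Wp\<close> to be \<open>t\<close>. The auxiliary \<open>B\<close> lies strictly above the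
  root of the moment and is thereby positive.\<close>

lemma ray_moment_ge:
  fixes \<mu> :: "real \<Rightarrow> 'a measure"
  assumes p: "p > 1" and ray: "unit_speed_ray p \<mu>" and t: "C < t"
    and C: "0 < C" "(\<integral>\<^sup>+x. ennreal (dist (q 0) x powr p) \<partial>\<mu> 0) \<le> ennreal (C powr p)"
  shows "ennreal ((t - C) powr p) \<le> (\<integral>\<^sup>+x. ennreal (dist (q 0) x powr p) \<partial>\<mu> t)"
proof (rule ccontr)
  let ?I = "\<integral>\<^sup>+x. ennreal (dist (q 0) x powr p) \<partial>\<mu> t"
  assume "\<not> ?thesis"
  then have less: "?I < ennreal ((t - C) powr p)" by simp
  then have "?I < \<infinity>" using less_trans by fastforce
  define v where "v = enn2real ?I"
  have v: "?I = ennreal v" "0 \<le> v" using \<open>?I < \<infinity>\<close> by (auto simp: v_def)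
  have "v < (t - C) powr p" using less v by (simp add: ennreal_less_iff)
  then have "v powr (1 / p) < ((t - C) powr p) powr (1 / p)"
    using v p by (intro powr_less_mono2) auto
  then have vt: "v powr (1 / p) < t - C" using p t by (simp add: powr_powr)
  then obtain B where B: "v powr (1 / p) < B" "B < t - C"
    using Orderings.dense by blast
  have "0 < B" using order_le_less_trans[OF powr_ge_zero B(1)] .
  have "(v powr (1 / p)) powr p \<le> B powr p" using B(1) p by (intro powr_mono2) auto
  then have "?I \<le> ennreal (B powr p)" using p v by (simp add: powr_powr ennreal_leI)
  have in_Pp: "\<mu> 0 \<in> Pp p" "\<mu> t \<in> Pp p" using unit_speed_rayD[OF ray] t C by auto
  have prod: "\<mu> 0 \<Otimes>\<^sub>M \<mu> t \<in> couplings (\<mu> 0) (\<mu> t)"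
    using in_Pp by (intro couplings_nonempty PpD)
  have "Wp p (\<mu> 0) (\<mu> t) \<le> C + B"
    using C \<open>0 < B\<close> by (intro Wp_le[OF p prod] couplings_cost[OF p prod C \<open>0 < B\<close> \<open>?I \<le> ennreal (B powr p)\<close>]) auto
  then show False using unit_speed_rayD(2)[OF ray, of 0 t] B t C by auto
qed

text \<open>Integrate \<open>convexity_defect\<close> over an almost optimal coupling of
  \<open>\<mu> s\<close> and \<open>\<mu> t\<close>. The left side is at least
  \<open>t - p * C\<close> plus \<open>s * ((p - 1) / 2)\<close> times the tail
  \<open>\<eta>\<close>; the right side is at most \<open>t\<close> plus a small multiple of
  \<open>s\<close> and a constant. Both \<open>s\<close> and \<open>R\<close> are fixed before
  \<open>t\<close>.\<close>

lemma ray_uniformly_integrable: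
  fixes \<mu> :: "real \<Rightarrow> 'a measure"
  assumes p: "p > 1" and ray: "unit_speed_ray p \<mu>" and e: "0 < e"
  shows "\<exists>R\<ge>0. \<exists>t0>0. \<forall>t\<ge>t0.
    (\<integral>\<^sup>+x. ennreal (max 0 (dist (q 0) x / t - R) powr p) \<partial>\<mu> t) \<le> ennreal e"
proof -
  have in_Pp: "\<mu> t \<in> Pp p" if "0 \<le> t" for t using unit_speed_rayD(1)[OF ray that] .
  obtain C where C: "0 < C" "(\<integral>\<^sup>+x. ennreal (dist (q 0) x powr p) \<partial>\<mu> 0) \<le> ennreal (C powr p)"
    using Pp_moment[OF p in_Pp[of 0]] by auto
  \<comment> \<open>Three errors \<open>s * \<epsilon>\<close> together match the gain
    \<open>s * ((p - 1) / 2) * e\<close>.\<close>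
  define \<epsilon> where "\<epsilon> = (p - 1) * e / 6"
  have \<epsilon>: "0 < \<epsilon>" using p e by (simp add: \<epsilon>_def)
  define c :: real where "c = 2 powr (p - 1)"
  have c: "0 < c" by (simp add: c_def)
  \<comment> \<open>Relative to \<open>s\<close>, the first difference is the excess of the rescaled
    moment of \<open>\<mu> s\<close> over 1. The last quotient collects the additive errors: 1 from
    the coupling and \<open>p * C\<close> from the lower moment bound.\<close>
  have "((\<lambda>s. (1 + (C + 1) / s) powr p - 1 + (1 + p * C) / s) \<longlongrightarrow> (1 + 0) powr p - 1 + 0) at_top"
    by (intro tendsto_intros tendsto_divide_0[OF tendsto_const] filterlim_at_top_imp_at_infinity
        filterlim_ident) auto
  then have "\<forall>\<^sub>F s in at_top. (1 + (C + 1) / s) powr p - 1 + (1 + p * C) / s < \<epsilon>"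
    using \<epsilon> by (intro order_tendstoD(2)) auto
  then have "\<forall>\<^sub>F s in at_top. 0 < s \<and> (1 + (C + 1) / s) powr p - 1 + (1 + p * C) / s < \<epsilon>"
    using eventually_gt_at_top[of 0] by eventually_elim auto
  then obtain s where s: "0 < s" "(1 + (C + 1) / s) powr p - 1 + (1 + p * C) / s < \<epsilon>"
    by (auto dest: eventually_happens)
  have [measurable_cong]: "sets (\<mu> s) = sets borel" using PpD(2)[OF in_Pp[of s]] s by simp
  have As: "(\<integral>\<^sup>+x. ennreal ((dist (q 0) x / s) powr p) \<partial>\<mu> s) \<le> ennreal (((C + (s + 1)) / s) powr p)"
    using s C by (intro nn_integral_scaled_le ray_moment_le[OF p ray]) auto
  have "\<exists>M\<ge>0. (\<integral>\<^sup>+x. ennreal ((dist (q 0) x / s) powr p * of_bool (M < dist (q 0) x / s)) \<partial>\<mu> s) \<le> ennreal (\<epsilon> / c)"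
    using order_le_less_trans[OF As ennreal_less_top] \<epsilon> c by (intro nn_integral_powr_tail) auto
  then obtain M where M: "0 \<le> M" and
    tail: "(\<integral>\<^sup>+x. ennreal ((dist (q 0) x / s) powr p * of_bool (M < dist (q 0) x / s)) \<partial>\<mu> s) \<le> ennreal (\<epsilon> / c)"
    by blast
  \<comment> \<open>Chosen to make \<open>c * (M / R) powr p * 2 powr p\<close> at most
    \<open>\<epsilon>\<close>, where \<open>2 powr p\<close> bounds the rescaled moment of
    \<open>\<mu> t\<close>; \<open>M + 1\<close> keeps \<open>R\<close> positive when
    \<open>M\<close> is 0.\<close>
  define \<delta> where "\<delta> = (\<epsilon> / (c * 2 powr p)) powr (1 / p)"
  have \<delta>: "0 < \<delta>" "\<delta> powr p = \<epsilon> / (c * 2 powr p)" using \<epsilon> c p by (auto simp: \<delta>_def powr_powr)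
  define R where "R = (M + 1) / \<delta>"
  have R: "0 < R" using M \<delta> by (simp add: R_def)
  have "M / R = \<delta> * (M / (M + 1))" using M \<delta> by (simp add: R_def)
  also have "\<dots> \<le> \<delta> * 1" using M \<delta> by (intro mult_left_mono) auto
  finally have "(M / R) powr p \<le> \<delta> powr p" using M R p by (intro powr_mono2) auto
  then have MR: "(M / R) powr p \<le> \<epsilon> / (c * 2 powr p)" by (simp add: \<delta>)
  have "(\<integral>\<^sup>+x. ennreal (max 0 (dist (q 0) x / t - R) powr p) \<partial>\<mu> t) \<le> ennreal e"
    if t: "s + C + 2 \<le> t" for t
  proof -
    have t': "0 < t" "s < t" "C < t" "C + 1 \<le> t" using t s C by auto
    \<comment> \<open>With this tolerance \<open>(t - s) * (A / (t - s)) powr p\<close> equals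
      \<open>t - s + 1\<close>: the coupling error is the constant 1, whatever \<open>t\<close>
      is.\<close>
    define A where "A = (t - s) * (1 + 1 / (t - s)) powr (1 / p)"
    have "(1::real) < (1 + 1 / (t - s)) powr (1 / p)"
      using t' p by simp
    then have "t - s < A" using t' unfolding A_def
      by (metis diff_gt_0_iff_gt mult.right_neutral mult_strict_left_mono)
    then obtain \<pi> where \<pi>: "\<pi> \<in> couplings (\<mu> s) (\<mu> t)" and
      cost: "(\<integral>\<^sup>+w. ennreal (dist (fst w) (snd w) powr p) \<partial>\<pi>) \<le> ennreal (A powr p)"
      using Wp_less_obtain[OF p, of "\<mu> s" "\<mu> t" A] in_Pp unit_speed_rayD(2)[OF ray, of s t] s t' by auto
    have [measurable_cong]: "sets \<pi> = sets borel" using \<pi> by (rule couplingsD)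
    have A: "0 < A" using \<open>t - s < A\<close> t' by simp
    have As_powr: "(A / (t - s)) powr p = 1 + 1 / (t - s)"
      using t' p by (simp add: A_def powr_powr)
    let ?a = "\<lambda>w. dist (q 0) (fst w) / s" and ?h = "\<lambda>w. dist (q 0) (snd w) / t"
      and ?b = "\<lambda>w. dist (fst w) (snd w :: 'a) / (t - s)"
    have a: "(\<integral>\<^sup>+w. ennreal (?a w powr p) \<partial>\<pi>) \<le> ennreal (((C + (s + 1)) / s) powr p)"
      using As by (subst nn_integral_coupling_fst[OF \<pi>, of "\<lambda>x. ennreal ((dist (q 0) x / s) powr p)"]) auto
    have a_tail: "(\<integral>\<^sup>+w. ennreal (?a w powr p * of_bool (M < ?a w)) \<partial>\<pi>) \<le> ennreal (\<epsilon> / c)"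
      using tail by (subst nn_integral_coupling_fst[OF \<pi>,
            of "\<lambda>x. ennreal ((dist (q 0) x / s) powr p * of_bool (M < dist (q 0) x / s))"]) auto
    have b: "(\<integral>\<^sup>+w. ennreal (?b w powr p) \<partial>\<pi>) \<le> ennreal (1 + 1 / (t - s))"
      unfolding As_powr[symmetric] using t' A cost by (intro nn_integral_scaled_le) auto
    have mom: "(\<integral>\<^sup>+w. ennreal (dist (q 0) (snd w) powr p) \<partial>\<pi>) = (\<integral>\<^sup>+x. ennreal (dist (q 0) x powr p) \<partial>\<mu> t)"
      by (rule nn_integral_coupling_snd[OF \<pi>]) measurable
    have "(\<integral>\<^sup>+w. ennreal (?h w powr p) \<partial>\<pi>) \<le> ennreal (((C + (t + 1)) / t) powr p)"
      using t' C ray_moment_le[OF p ray _ C, of t] by (intro nn_integral_scaled_le) (auto simp: mom)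
    also have "\<dots> \<le> ennreal (2 powr p)"
      using t' C p by (intro ennreal_leI powr_mono2) (auto simp: field_simps)
    finally have h: "(\<integral>\<^sup>+w. ennreal (?h w powr p) \<partial>\<pi>) \<le> ennreal (2 powr p)" .
    have h_tail: "(\<integral>\<^sup>+w. ennreal (?h w powr p * of_bool (R < ?h w)) \<partial>\<pi>) \<le> ennreal (2 powr p)"
      by (rule order_trans[OF _ h], intro nn_integral_mono) (auto simp: of_bool_def)
    have [measurable]: "?a \<in> borel_measurable \<pi>" "?h \<in> borel_measurable \<pi>" "?b \<in> borel_measurable \<pi>"
      by measurable
    have [measurable]: "(\<lambda>w. ?a w powr p * of_bool (M < ?a w)) \<in> borel_measurable \<pi>"
      "(\<lambda>w. ?h w powr p * of_bool (R < ?h w)) \<in> borel_measurable \<pi>"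
      unfolding of_bool_def by measurable
    have Ia: "integrable \<pi> (\<lambda>w. ?a w powr p)" "(\<integral>w. ?a w powr p \<partial>\<pi>) \<le> ((C + (s + 1)) / s) powr p"
      by (rule nn_integral_le_imp_integral_le[OF _ _ _ a]; simp)+
    have Iat: "integrable \<pi> (\<lambda>w. ?a w powr p * of_bool (M < ?a w))"
      "(\<integral>w. ?a w powr p * of_bool (M < ?a w) \<partial>\<pi>) \<le> \<epsilon> / c"
      by (rule nn_integral_le_imp_integral_le[OF _ _ _ a_tail]; use \<epsilon> c in simp)+
    have Ib: "integrable \<pi> (\<lambda>w. ?b w powr p)" "(\<integral>w. ?b w powr p \<partial>\<pi>) \<le> 1 + 1 / (t - s)"
      by (rule nn_integral_le_imp_integral_le[OF _ _ _ b]; use t' in simp)+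
    have Ih: "integrable \<pi> (\<lambda>w. ?h w powr p)" "(\<integral>w. ?h w powr p \<partial>\<pi>) \<le> 2 powr p"
      by (rule nn_integral_le_imp_integral_le[OF _ _ _ h]; simp)+
    have Iht: "integrable \<pi> (\<lambda>w. ?h w powr p * of_bool (R < ?h w))"
      by (rule nn_integral_le_imp_integral_le[OF _ _ _ h_tail]; simp)
    define k where "k = (\<integral>w. ?h w powr p \<partial>\<pi>)"
    define \<eta> where "\<eta> = (\<integral>w. ?h w powr p * of_bool (R < ?h w) \<partial>\<pi>)"
    have k: "0 \<le> k" "k \<le> 2 powr p" using Ih by (auto simp: k_def)
    have "(1 - C / t) powr p \<le> k"
    proof -
      have "ennreal ((t - C) powr p) \<le> (\<integral>\<^sup>+w. ennreal (t powr p) * ennreal (?h w powr p) \<partial>\<pi>)"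
        using ray_moment_ge[OF p ray t'(3) C] t'
        by (subst (asm) mom[symmetric]) (simp add: ennreal_mult'[symmetric] powr_divide)
      also have "\<dots> = ennreal (t powr p) * (\<integral>\<^sup>+w. ennreal (?h w powr p) \<partial>\<pi>)"
        by (rule nn_integral_cmult) measurable
      also have "\<dots> = ennreal (t powr p * k)"
        unfolding k_def by (subst nn_integral_eq_integral[OF Ih(1)]) (auto simp: ennreal_mult')
      finally have "(t - C) powr p \<le> t powr p * k" using k by simp
      then have "(t - C) powr p / t powr p \<le> k" using t' by (subst pos_divide_le_eq) (auto simp: mult.commute)
      moreover have "(1 - C / t) powr p = (t - C) powr p / t powr p"
        using t' by (simp add: powr_divide[symmetric] diff_divide_distrib)
      ultimately show ?thesis by metis
    qed
    \<comment> \<open>The tangent at 1 turns the power into a linear bound, so multiplication by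
      \<open>t\<close> leaves only the constant loss \<open>p * C\<close>.\<close>
    moreover have "p * (1 - C / t) \<le> (1 - C / t) powr p + (p - 1)"
      using young_powr[OF p, of "1 - C / t" 1] t' by simp
    ultimately have "1 - p * C / t \<le> k" by (simp add: algebra_simps)
    then have "t * (1 - p * C / t) \<le> t * k" using t' by (intro mult_left_mono) auto
    then have tk: "t - p * C \<le> t * k" using t' by (simp add: algebra_simps)
    have "(\<integral>w. t * ?h w powr p + s * ((p - 1) / 2) * (?h w powr p * of_bool (R < ?h w)) \<partial>\<pi>) \<le>
      (\<integral>w. s * ?a w powr p + s * c * ((M / R) powr p * ?h w powr p + ?a w powr p * of_bool (M < ?a w))
        + (t - s) * ?b w powr p \<partial>\<pi>)"
    proof (rule integral_mono)
      fix w
      have "t * ?h w \<le> s * ?a w + (t - s) * ?b w"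
        using t' s dist_triangle[of "q 0" "snd w" "fst w"] by simp
      then show "t * ?h w powr p + s * ((p - 1) / 2) * (?h w powr p * of_bool (R < ?h w)) \<le>
        s * ?a w powr p + s * c * ((M / R) powr p * ?h w powr p + ?a w powr p * of_bool (M < ?a w))
        + (t - s) * ?b w powr p"
        unfolding c_def using p t' s M R by (intro convexity_defect) auto
    qed (intro Bochner_Integration.integrable_add integrable_mult_right Ia Iat Ib Ih Iht)+
    also have "(\<integral>w. t * ?h w powr p + s * ((p - 1) / 2) * (?h w powr p * of_bool (R < ?h w)) \<partial>\<pi>)
        = t * k + s * ((p - 1) / 2) * \<eta>"
      unfolding k_def \<eta>_def
      by (subst Bochner_Integration.integral_add)
         (auto intro!: Bochner_Integration.integrable_add integrable_mult_right Ia Iat Ib Ih Iht simp del: times_divide_eq_right times_divide_eq_left)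
    also have "(\<integral>w. s * ?a w powr p + s * c * ((M / R) powr p * ?h w powr p + ?a w powr p * of_bool (M < ?a w))
        + (t - s) * ?b w powr p \<partial>\<pi>) = s * (\<integral>w. ?a w powr p \<partial>\<pi>) +
        s * c * ((M / R) powr p * k + (\<integral>w. ?a w powr p * of_bool (M < ?a w) \<partial>\<pi>)) + (t - s) * (\<integral>w. ?b w powr p \<partial>\<pi>)"
      unfolding k_def
      by (subst Bochner_Integration.integral_add Bochner_Integration.integral_mult_right_zero
            | (intro Bochner_Integration.integrable_add integrable_mult_right Ia Iat Ib Ih Iht))+ simp
    also have "\<dots> \<le> s * (((C + (s + 1)) / s) powr p) + s * c * (\<epsilon> / (c * 2 powr p) * 2 powr p + \<epsilon> / c)
        + (t - s) * (1 + 1 / (t - s))"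
      using s c t' k M R \<epsilon> by (intro add_mono mult_left_mono mult_mono Ia Iat Ib MR) auto
    also have "\<dots> = s * (((C + (s + 1)) / s) powr p) + 2 * (s * \<epsilon>) + (t - s) + 1"
      using s c t' by (simp add: field_simps)
    finally have "s * ((p - 1) / 2) * \<eta> \<le> s * (((C + (s + 1)) / s) powr p) + 2 * (s * \<epsilon>) - s + 1 + p * C"
      using tk by linarith
    also have "(C + (s + 1)) / s = 1 + (C + 1) / s" using s by (simp add: field_simps)
    also have "s * (1 + (C + 1) / s) powr p + 2 * (s * \<epsilon>) - s + 1 + p * C
        = s * ((1 + (C + 1) / s) powr p - 1 + (1 + p * C) / s) + 2 * (s * \<epsilon>)"
      using s by (simp add: field_simps)
    also have "\<dots> \<le> s * \<epsilon> + 2 * (s * \<epsilon>)" using s by (intro add_mono mult_left_mono) auto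
    also have "\<dots> = s * ((p - 1) / 2) * e" by (simp add: \<epsilon>_def)
    finally have \<eta>: "\<eta> \<le> e" using s p by (simp add: mult_le_cancel_left)
    have "(\<integral>\<^sup>+x. ennreal (max 0 (dist (q 0) x / t - R) powr p) \<partial>\<mu> t)
        = (\<integral>\<^sup>+w. ennreal (max 0 (?h w - R) powr p) \<partial>\<pi>)"
      by (rule nn_integral_coupling_snd[OF \<pi>, symmetric]) measurable
    also have "\<dots> \<le> (\<integral>\<^sup>+w. ennreal (?h w powr p * of_bool (R < ?h w)) \<partial>\<pi>)"
      using p R by (intro nn_integral_mono ennreal_leI excess_powr_le) auto
    also have "\<dots> = ennreal \<eta>"
      unfolding \<eta>_def by (rule nn_integral_eq_integral[OF Iht]) auto
    also have "\<dots> \<le> ennreal e" using \<eta> by (rule ennreal_leI)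
    finally show ?thesis .
  qed
  then show ?thesis
    using R s C by (intro exI[of _ R] conjI exI[of _ "s + C + 2"]) auto
qed

end

section \<open>Busemann functions\<close>

context dense_sequence
begin

lemma Wp_diff_antimono:
  fixes \<mu> :: "real \<Rightarrow> 'a measure"
  assumes "p > 1" "unit_speed_ray p \<mu>" "\<nu> \<in> Pp p" "0 \<le> s" "s \<le> t"
  shows "Wp p \<nu> (\<mu> t) - t \<le> Wp p \<nu> (\<mu> s) - s"
  using Wp_triangle[of p \<nu> "\<mu> s" "\<mu> t"] unit_speed_rayD[OF assms(2)] assms by auto

lemma Wp_diff_ge:
  fixes \<mu> :: "real \<Rightarrow> 'a measure"
  assumes "p > 1" "unit_speed_ray p \<mu>" "\<nu> \<in> Pp p" "0 \<le> t"
  shows "- Wp p (\<mu> 0) \<nu> \<le> Wp p \<nu> (\<mu> t) - t"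
  using Wp_triangle[of p "\<mu> 0" \<nu> "\<mu> t"] unit_speed_rayD[OF assms(2)] assms by auto

text \<open>By the triangle inequality the difference is nonincreasing in \<open>t\<close> and
  bounded below, so its limit is its infimum. Every finite time hence bounds the Busemann function
  from above.\<close>

lemma busemann_limit:
  fixes \<mu> :: "real \<Rightarrow> 'a measure"
  assumes p: "p > 1" and ray: "unit_speed_ray p \<mu>" and \<nu>: "\<nu> \<in> Pp p"
  shows "((\<lambda>t. Wp p \<nu> (\<mu> t) - t) \<longlongrightarrow> busemann p \<mu> \<nu>) at_top"
    and "0 \<le> t \<Longrightarrow> busemann p \<mu> \<nu> \<le> Wp p \<nu> (\<mu> t) - t"
proof -
  define f where "f t = Wp p \<nu> (\<mu> t) - t" for t
  define L where "L = Inf (f ` {0..})"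
  have bdd: "bdd_below (f ` {0..})"
    using Wp_diff_ge[OF p ray \<nu>] by (intro bdd_belowI[of _ "- Wp p (\<mu> 0) \<nu>"]) (auto simp: f_def)
  have lower: "L \<le> f t" if "0 \<le> t" for t
    unfolding L_def using bdd that by (intro cInf_lower) auto
  have lim: "(f \<longlongrightarrow> L) at_top"
  proof (rule order_tendstoI)
    fix a assume "a < L"
    then show "\<forall>\<^sub>F t in at_top. a < f t"
      by (intro eventually_mono[OF eventually_ge_at_top[of 0]] less_le_trans[OF _ lower])
  next
    fix a assume "L < a"
    then obtain s where s: "0 \<le> s" "f s < a"
      unfolding L_def using cInf_lessD[of "f ` {0..}" a] by auto
    show "\<forall>\<^sub>F t in at_top. f t < a"
      by (rule eventually_mono[OF eventually_ge_at_top[of s]])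
         (use s Wp_diff_antimono[OF p ray \<nu> s(1)] in \<open>fastforce simp: f_def\<close>)
  qed
  have "busemann p \<mu> \<nu> = L"
    unfolding busemann_def f_def[symmetric] by (intro tendsto_Lim lim) simp
  then show "((\<lambda>t. Wp p \<nu> (\<mu> t) - t) \<longlongrightarrow> busemann p \<mu> \<nu>) at_top"
    and "0 \<le> t \<Longrightarrow> busemann p \<mu> \<nu> \<le> Wp p \<nu> (\<mu> t) - t"
    using lim lower[of t] unfolding f_def by auto
qed

lemma busemann_le_Wp_add:
  fixes \<mu> :: "real \<Rightarrow> 'a measure"
  assumes p: "p > 1" and ray: "unit_speed_ray p \<mu>" and \<nu>: "\<nu> \<in> Pp p" and la: "la \<in> Pp p"
  shows "busemann p \<mu> \<nu> \<le> Wp p \<nu> la + busemann p \<mu> la"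
proof (rule tendsto_le[OF _ tendsto_add[OF tendsto_const busemann_limit(1)[OF p ray la]]
      busemann_limit(1)[OF p ray \<nu>]])
  show "\<forall>\<^sub>F t in at_top. Wp p \<nu> (\<mu> t) - t \<le> Wp p \<nu> la + (Wp p la (\<mu> t) - t)"
    using eventually_ge_at_top[of 0]
  proof eventually_elim
    case (elim t)
    then show ?case
      using Wp_triangle[OF p \<nu> la unit_speed_rayD(1)[OF ray elim]] by simp
  qed
qed simp

text \<open>Density of \<open>q\<close> turns an approximate interpolation point into one of the
  \<open>q i\<close>. The least index satisfying both strict inequalities depends measurably on the
  pair.\<close>

lemma measurable_interpolation:
  assumes len: "length_space TYPE('a)" and \<theta>: "0 \<le> \<theta>" "\<theta> \<le> 1" and e: "0 < e"
  obtains z where "z \<in> (borel :: ('a \<times> 'a) measure) \<rightarrow>\<^sub>M (borel :: 'a measure)"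
    "\<And>w. dist (fst w) (z w) \<le> \<theta> * dist (fst w) (snd w) + e"
    "\<And>w. dist (z w) (snd w) \<le> (1 - \<theta>) * dist (fst w) (snd w) + e"
proof -
  let ?P = "\<lambda>w i. dist (fst w) (q i) < \<theta> * dist (fst w) (snd w) + e \<and>
    dist (q i) (snd w) < (1 - \<theta>) * dist (fst w) (snd w) + e"
  have ex: "\<exists>i. ?P w i" for w
  proof -
    obtain v where v: "dist (fst w) v = \<theta> * dist (fst w) (snd w)"
      "dist v (snd w) \<le> (1 - \<theta>) * dist (fst w) (snd w) + e / 2"
      using length_space_interpolate[OF len \<theta>, of "e / 2" "fst w" "snd w"] e by auto
    obtain i where "dist v (q i) < e / 2" using dense[of "e / 2" v] e by auto
    then have "?P w i"
      using v e dist_triangle[of "fst w" "q i" v] dist_triangle[of "q i" "snd w" v]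
      by (auto simp: dist_commute)
    then show ?thesis ..
  qed
  define L where "L w = (LEAST i. ?P w i)" for w
  have mL: "L \<in> borel \<rightarrow>\<^sub>M count_space UNIV"
    unfolding L_def by measurable
  have L: "?P w (L w)" for w unfolding L_def by (rule LeastI_ex[OF ex])
  show ?thesis
  proof (rule that[of "\<lambda>w. q (L w)"])
    show "(\<lambda>w. q (L w)) \<in> borel_measurable borel"
      by (rule measurable_compose[OF mL]) simp
  qed (use L in \<open>auto intro: less_imp_le\<close>)
qed

text \<open>Push an almost optimal coupling forward by the interpolation with parameter
  \<open>1 / T\<close>. The coupling and the interpolation each contribute an error of at most
  \<open>\<delta>\<close>; the pointwise bound on \<open>z\<close> is kept for the tail
  estimate.\<close>

lemma approximate_interpolant:
  fixes \<nu> m :: "'a measure"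
  assumes p: "p > 1" and len: "length_space TYPE('a)" and \<nu>: "\<nu> \<in> Pp p" and m: "m \<in> Pp p"
    and T: "T = Wp p \<nu> m" "1 < T" and \<delta>: "0 < \<delta>"
  obtains \<pi> z where "\<pi> \<in> couplings \<nu> m" "z \<in> borel \<rightarrow>\<^sub>M borel"
    "\<And>w. dist (fst w) (z w) \<le> dist (fst w) (snd w) / T + \<delta>"
    "(\<integral>\<^sup>+w. ennreal (dist (fst w) (z w) powr p) \<partial>\<pi>) \<le> ennreal ((1 + 2 * \<delta>) powr p)"
    "Wp p \<nu> (distr \<pi> borel z) \<le> 1 + 2 * \<delta>" "Wp p (distr \<pi> borel z) m \<le> T - 1 + 2 * \<delta>"
proof -
  obtain \<pi> where \<pi>: "\<pi> \<in> couplings \<nu> m"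
    and cost: "(\<integral>\<^sup>+w. ennreal (dist (fst w) (snd w) powr p) \<partial>\<pi>) \<le> ennreal ((T + \<delta>) powr p)"
    using Wp_less_obtain[OF p \<nu> m, of "T + \<delta>"] T \<delta> by auto
  interpret prob_space \<pi> using \<pi> by (rule couplingsD)
  have [measurable_cong]: "sets \<pi> = sets borel" using \<pi> by (rule couplingsD)
  obtain z :: "'a \<times> 'a \<Rightarrow> 'a" where z[measurable]: "z \<in> borel \<rightarrow>\<^sub>M borel" and
    z1: "\<And>w. dist (fst w) (z w) \<le> 1 / T * dist (fst w) (snd w) + \<delta>" and
    z2: "\<And>w. dist (z w) (snd w) \<le> (1 - 1 / T) * dist (fst w) (snd w) + \<delta>"
    by (rule measurable_interpolation[OF len _ _ \<delta>, of "1 / T"]) (use T in auto)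
  have z'[measurable]: "z \<in> \<pi> \<rightarrow>\<^sub>M borel" by measurable
  \<comment> \<open>\<open>T / (T - 1)\<close> is the reciprocal of \<open>1 - 1 / T\<close>, so
    that both pieces are treated as divisions by a positive scale.\<close>
  have T': "0 < T" "0 < T / (T - 1)" using T by auto
  have const: "(\<integral>\<^sup>+w. ennreal (\<delta> powr p) \<partial>\<pi>) \<le> ennreal (\<delta> powr p)"
    by (simp add: emeasure_space_1)
  have "(\<integral>\<^sup>+w. ennreal (dist (fst w) (z w) powr p) \<partial>\<pi>)
      \<le> (\<integral>\<^sup>+w. ennreal ((dist (fst w) (snd w) / T + \<delta>) powr p) \<partial>\<pi>)"
    using p z1 by (intro nn_integral_mono ennreal_leI powr_mono2) auto
  also have "\<dots> \<le> ennreal (((T + \<delta>) / T + \<delta>) powr p)"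
    using T' \<delta> cost by (intro Minkowski_nn_integral[OF p] nn_integral_scaled_le const) auto
  also have "\<dots> \<le> ennreal ((1 + 2 * \<delta>) powr p)"
  proof -
    have "\<delta> / T \<le> \<delta> / 1" using T \<delta> by (intro divide_left_mono) auto
    then have "(T + \<delta>) / T + \<delta> \<le> 1 + 2 * \<delta>" using T' by (simp add: add_divide_distrib)
    then show ?thesis using T' \<delta> p by (intro ennreal_leI powr_mono2) auto
  qed
  finally have c1: "(\<integral>\<^sup>+w. ennreal (dist (fst w) (z w) powr p) \<partial>\<pi>) \<le> ennreal ((1 + 2 * \<delta>) powr p)" .
  have "(\<integral>\<^sup>+w. ennreal (dist (z w) (snd w) powr p) \<partial>\<pi>)
      \<le> (\<integral>\<^sup>+w. ennreal ((dist (fst w) (snd w) / (T / (T - 1)) + \<delta>) powr p) \<partial>\<pi>)"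
  proof (intro nn_integral_mono ennreal_leI powr_mono2)
    fix w
    have "(1 - 1 / T) = 1 / (T / (T - 1))" using T by (simp add: field_simps)
    then show "dist (z w) (snd w) \<le> dist (fst w) (snd w) / (T / (T - 1)) + \<delta>"
      using z2[of w] by (simp add: mult.commute)
  qed (use p in auto)
  also have "\<dots> \<le> ennreal (((T + \<delta>) / (T / (T - 1)) + \<delta>) powr p)"
    using T T' \<delta> cost by (intro Minkowski_nn_integral[OF p] nn_integral_scaled_le const) auto
  also have "\<dots> \<le> ennreal ((T - 1 + 2 * \<delta>) powr p)"
  proof -
    have "(T + \<delta>) / (T / (T - 1)) = T - 1 + \<delta> * (1 - 1 / T)"
      using T by (simp add: field_simps)
    also have "\<dots> \<le> T - 1 + \<delta> * 1" using T \<delta> by (intro add_mono mult_left_mono) auto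
    finally have "(T + \<delta>) / (T / (T - 1)) + \<delta> \<le> T - 1 + 2 * \<delta>" by simp
    then show ?thesis using T T' \<delta> p by (intro ennreal_leI powr_mono2) auto
  qed
  finally have c2: "(\<integral>\<^sup>+w. ennreal (dist (z w) (snd w) powr p) \<partial>\<pi>) \<le> ennreal ((T - 1 + 2 * \<delta>) powr p)" .
  have W1: "Wp p \<nu> (distr \<pi> borel z) \<le> 1 + 2 * \<delta>"
    by (rule Wp_le_random_variables[OF p prob_space_axioms _ z' couplingsD(3)[OF \<pi>] refl _ c1])
       (use \<delta> in auto)
  have W2: "Wp p (distr \<pi> borel z) m \<le> T - 1 + 2 * \<delta>"
    by (rule Wp_le_random_variables[OF p prob_space_axioms z' _ refl couplingsD(4)[OF \<pi>] _ c2])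
       (use \<delta> T in auto)
  show ?thesis
    by (rule that[OF \<pi> z _ c1 W1 W2]) (use z1 in auto)
qed

end

section \<open>Limits of interpolants along the ray\<close>

context proper_space
begin

lemma interpolants_along_ray:
  fixes \<mu> :: "real \<Rightarrow> 'a measure"
  assumes p: "p > 1" and len: "length_space TYPE('a)" and ray: "unit_speed_ray p \<mu>" and \<nu>: "\<nu> \<in> Pp p"
  obtains la t \<delta> and l where
    "filterlim t at_top sequentially" "\<delta> \<longlonglongrightarrow> 0" "l \<in> Pp p"
    "\<And>n::nat. la n \<in> Pp p" "\<And>n. 0 \<le> t n"
    "\<And>n. Wp p \<nu> (la n) \<le> 1 + \<delta> n" "\<And>n. Wp p (la n) (\<mu> (t n)) \<le> Wp p \<nu> (\<mu> (t n)) - 1 + \<delta> n"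
    "(\<lambda>n. Wp p (la n) l) \<longlonglongrightarrow> 0"
proof -
  let ?D = "dist (q 0)"
  define c0 where "c0 = Wp p (\<mu> 0) \<nu>"
  have c0: "0 \<le> c0" by (simp add: c0_def Wp_nonneg)
  \<comment> \<open>Since \<open>Wp p \<nu> (\<mu> (t n))\<close> is at least
    \<open>t n - c0\<close>, this offset makes it at least \<open>t n / 2\<close> and larger than
    1.\<close>
  define t where "t n = real n + (2 * c0 + 4)" for n :: nat
  define T where "T n = Wp p \<nu> (\<mu> (t n))" for n
  define \<delta> where "\<delta> n = 1 / real (Suc n)" for n
  have t: "0 < t n" "2 * c0 + 4 \<le> t n" for n using c0 by (auto simp: t_def)
  have \<mu>: "\<mu> (t n) \<in> Pp p" for n using unit_speed_rayD(1)[OF ray] t(1)[of n] by simp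
  have T: "t n / 2 \<le> T n" "1 < T n" for n
    using Wp_diff_ge[OF p ray \<nu> less_imp_le[OF t(1)[of n]]] t(2)[of n] c0
    unfolding T_def c0_def by linarith+
  have \<delta>: "0 < \<delta> n" "\<delta> n \<le> 1" for n by (auto simp: \<delta>_def)
  define good where "good n v \<longleftrightarrow> fst v \<in> couplings \<nu> (\<mu> (t n)) \<and> snd v \<in> borel \<rightarrow>\<^sub>M borel \<and>
    (\<forall>w. dist (fst w) (snd v w) \<le> dist (fst w) (snd w) / T n + \<delta> n) \<and>
    (\<integral>\<^sup>+w. ennreal (dist (fst w) (snd v w) powr p) \<partial>fst v) \<le> ennreal ((1 + 2 * \<delta> n) powr p) \<and>
    Wp p \<nu> (distr (fst v) borel (snd v)) \<le> 1 + 2 * \<delta> n \<and>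
    Wp p (distr (fst v) borel (snd v)) (\<mu> (t n)) \<le> T n - 1 + 2 * \<delta> n" for n v
  have "\<exists>v. good n v" for n
  proof (rule approximate_interpolant[OF p len \<nu> \<mu>[of n] T_def[of n] T(2)[of n] \<delta>(1)[of n]])
    fix \<pi> z
    assume "\<pi> \<in> couplings \<nu> (\<mu> (t n))" "z \<in> borel \<rightarrow>\<^sub>M borel"
      "\<And>w. dist (fst w) (z w) \<le> dist (fst w) (snd w) / T n + \<delta> n"
      "(\<integral>\<^sup>+w. ennreal (dist (fst w) (z w) powr p) \<partial>\<pi>) \<le> ennreal ((1 + 2 * \<delta> n) powr p)"
      "Wp p \<nu> (distr \<pi> borel z) \<le> 1 + 2 * \<delta> n"
      "Wp p (distr \<pi> borel z) (\<mu> (t n)) \<le> T n - 1 + 2 * \<delta> n"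
    then have "good n (\<pi>, z)" by (simp add: good_def)
    then show ?thesis ..
  qed
  then obtain v where v: "\<And>n. good n (v n)" by metis
  define \<pi> where "\<pi> n = fst (v n)" for n
  define z where "z n = snd (v n)" for n
  have \<pi>: "\<pi> n \<in> couplings \<nu> (\<mu> (t n))" and
    z[measurable]: "z n \<in> borel \<rightarrow>\<^sub>M borel" and
    z1: "dist (fst w) (z n w) \<le> dist (fst w) (snd w) / T n + \<delta> n" and
    c1: "(\<integral>\<^sup>+w. ennreal (dist (fst w) (z n w) powr p) \<partial>\<pi> n) \<le> ennreal ((1 + 2 * \<delta> n) powr p)" and
    W1: "Wp p \<nu> (distr (\<pi> n) borel (z n)) \<le> 1 + 2 * \<delta> n" and
    W2: "Wp p (distr (\<pi> n) borel (z n)) (\<mu> (t n)) \<le> T n - 1 + 2 * \<delta> n" for n w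
    using v[of n] unfolding good_def \<pi>_def z_def by blast+
  have [measurable_cong]: "sets (\<pi> n) = sets borel" for n using \<pi> by (rule couplingsD)
  define la where "la n = distr (\<pi> n) borel (z n)" for n
  have z': "z n \<in> \<pi> n \<rightarrow>\<^sub>M borel" for n by measurable
  have prob: "prob_space (la n)" for n
    unfolding la_def by (intro prob_space.prob_space_distr couplingsD(1)[OF \<pi>] z')
  have sets: "sets (la n) = sets borel" for n by (simp add: la_def)
  have int: "(\<integral>\<^sup>+x. f x \<partial>la n) = (\<integral>\<^sup>+w. f (z n w) \<partial>\<pi> n)" if "f \<in> borel_measurable borel" for f n
    unfolding la_def using that by (intro nn_integral_distr z') auto
  obtain A where A: "0 < A" "(\<integral>\<^sup>+x. ennreal (?D x powr p) \<partial>\<nu>) \<le> ennreal (A powr p)"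
    using Pp_moment[OF p \<nu>] .
  have bound: "(\<integral>\<^sup>+x. ennreal (?D x powr p) \<partial>la n) \<le> ennreal ((A + 3) powr p)" for n
  proof -
    have "(\<integral>\<^sup>+x. ennreal (?D x powr p) \<partial>la n) = (\<integral>\<^sup>+w. ennreal (?D (z n w) powr p) \<partial>\<pi> n)"
      by (rule int) measurable
    also have "\<dots> \<le> (\<integral>\<^sup>+w. ennreal ((?D (fst w) + dist (fst w) (z n w)) powr p) \<partial>\<pi> n)"
      using p by (intro nn_integral_mono ennreal_leI powr_mono2 dist_triangle) auto
    also have "\<dots> \<le> ennreal ((A + (1 + 2 * \<delta> n)) powr p)"
      using A c1[of n] \<delta>[of n] nn_integral_coupling_fst[OF \<pi>, of "\<lambda>x. ennreal (?D x powr p)" n]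
      by (intro Minkowski_nn_integral[OF p]) auto
    also have "\<dots> \<le> ennreal ((A + 3) powr p)"
      using A \<delta>[of n] p by (intro ennreal_leI powr_mono2) auto
    finally show ?thesis .
  qed
  have in_Pp: "la n \<in> Pp p" for n
    unfolding Pp_def using prob[of n] sets[of n] order_le_less_trans[OF bound[of n] ennreal_less_top]
    by auto
  have tail: "\<exists>R\<ge>0. \<exists>N. \<forall>n\<ge>N. (\<integral>\<^sup>+x. ennreal (max 0 (?D x - R) powr p) \<partial>la n) \<le> ennreal e"
    if e: "0 < e" for e
  proof -
    \<comment> \<open>Two tails, each multiplied by \<open>2 powr p\<close> twice: for the factor 2
      taken out of the power and for splitting the sum.\<close>
    define e1 where "e1 = e / (2 * (2 powr p * 2 powr p))"
    have e1: "0 < e1" using e by (simp add: e1_def)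
    have [measurable_cong]: "sets \<nu> = sets borel" using \<nu> by (rule PpD)
    obtain R1 where R1: "0 \<le> R1" "(\<integral>\<^sup>+x. ennreal (?D x powr p * of_bool (R1 < ?D x)) \<partial>\<nu>) \<le> ennreal e1"
      using nn_integral_powr_tail[of ?D \<nu> p e1] order_le_less_trans[OF A(2) ennreal_less_top] e1 by auto
    obtain R2 t0 where R2: "0 \<le> R2" and t0:
      "\<And>t. t0 \<le> t \<Longrightarrow> (\<integral>\<^sup>+x. ennreal (max 0 (?D x / t - R2) powr p) \<partial>\<mu> t) \<le> ennreal e1"
      using ray_uniformly_integrable[OF p ray e1] by blast
    obtain N :: nat where N: "t0 \<le> real N" using real_arch_simple by blast
    let ?u = "\<lambda>x. max 0 (?D x - R1) powr p" and ?v = "\<lambda>n x. max 0 (?D x / t n - R2) powr p"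
    have u: "(\<integral>\<^sup>+x. ennreal (?u x) \<partial>\<nu>) \<le> ennreal e1"
      by (rule order_trans[OF _ R1(2)], intro nn_integral_mono ennreal_leI excess_powr_le p R1)
    have "(\<integral>\<^sup>+x. ennreal (max 0 (?D x - (1 + 2 * R1 + 2 * R2)) powr p) \<partial>la n) \<le> ennreal e"
      if n: "N \<le> n" for n
    proof -
      have "t0 \<le> t n" using N n c0 unfolding t_def by linarith
      note v = t0[OF this]
      have "(\<integral>\<^sup>+x. ennreal (max 0 (?D x - (1 + 2 * R1 + 2 * R2)) powr p) \<partial>la n)
          = (\<integral>\<^sup>+w. ennreal (max 0 (?D (z n w) - (1 + 2 * R1 + 2 * R2)) powr p) \<partial>\<pi> n)"
        by (rule int) measurable
      also have "\<dots> \<le> (\<integral>\<^sup>+w. ennreal (2 powr p * 2 powr p) * (ennreal (?u (fst w)) + ennreal (?v n (snd w))) \<partial>\<pi> n)"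
      proof (rule nn_integral_mono)
        fix w
        have "dist (fst w) (snd w) / T n \<le> (?D (fst w) + ?D (snd w)) / T n"
          using T(2)[of n] dist_triangle3[of "fst w" "snd w" "q 0"] by (intro divide_right_mono) auto
        moreover have "?D (fst w) / T n \<le> ?D (fst w) / 1"
          using T(2)[of n] by (intro divide_left_mono) auto
        moreover have "?D (snd w) / T n \<le> 2 * (?D (snd w) / t n)"
        proof -
          have "?D (snd w) / T n \<le> ?D (snd w) / (t n / 2)"
            using T[of n] t(1)[of n] by (intro divide_left_mono) auto
          then show ?thesis by (simp add: mult.commute)
        qed
        \<comment> \<open>This estimate dictates the threshold \<open>1 + 2 * R1 + 2 * R2\<close>:
          an excess of the interpolant over it is paid for by the excess of an endpoint.\<close>
        ultimately have "?D (z n w) \<le> 2 * ?D (fst w) + 2 * (?D (snd w) / t n) + 1"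
          using dist_triangle[of "q 0" "z n w" "fst w"] z1[of w n] \<delta>(2)[of n]
          unfolding add_divide_distrib by linarith
        then have "max 0 (?D (z n w) - (1 + 2 * R1 + 2 * R2))
            \<le> 2 * (max 0 (?D (fst w) - R1) + max 0 (?D (snd w) / t n - R2))"
          by (auto simp: max_def)
        then have "max 0 (?D (z n w) - (1 + 2 * R1 + 2 * R2)) powr p
            \<le> (2 * (max 0 (?D (fst w) - R1) + max 0 (?D (snd w) / t n - R2))) powr p"
          using p by (intro powr_mono2) auto
        also have "\<dots> = 2 powr p * (max 0 (?D (fst w) - R1) + max 0 (?D (snd w) / t n - R2)) powr p"
          by (rule powr_mult)
        also have "\<dots> \<le> 2 powr p * (2 powr p * (?u (fst w) + ?v n (snd w)))"
          using p by (intro mult_left_mono powr_add_le) auto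
        finally show "ennreal (max 0 (?D (z n w) - (1 + 2 * R1 + 2 * R2)) powr p)
            \<le> ennreal (2 powr p * 2 powr p) * (ennreal (?u (fst w)) + ennreal (?v n (snd w)))"
          by (simp add: ennreal_mult'[symmetric] ennreal_plus[symmetric] ennreal_leI mult.assoc del: ennreal_plus)
      qed
      also have "\<dots> = ennreal (2 powr p * 2 powr p) *
          ((\<integral>\<^sup>+w. ennreal (?u (fst w)) \<partial>\<pi> n) + (\<integral>\<^sup>+w. ennreal (?v n (snd w)) \<partial>\<pi> n))"
        by (subst nn_integral_cmult, measurable) (simp add: nn_integral_add)
      also have "(\<integral>\<^sup>+w. ennreal (?u (fst w)) \<partial>\<pi> n) = (\<integral>\<^sup>+x. ennreal (?u x) \<partial>\<nu>)"
        by (rule nn_integral_coupling_fst[OF \<pi>]) measurable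
      also have "(\<integral>\<^sup>+w. ennreal (?v n (snd w)) \<partial>\<pi> n) = (\<integral>\<^sup>+x. ennreal (?v n x) \<partial>\<mu> (t n))"
        by (rule nn_integral_coupling_snd[OF \<pi>]) measurable
      also have "ennreal (2 powr p * 2 powr p) * ((\<integral>\<^sup>+x. ennreal (?u x) \<partial>\<nu>) + (\<integral>\<^sup>+x. ennreal (?v n x) \<partial>\<mu> (t n)))
          \<le> ennreal (2 powr p * 2 powr p) * (ennreal e1 + ennreal e1)"
        by (intro mult_left_mono add_mono u v) auto
      also have "\<dots> = ennreal ((2 powr p * 2 powr p) * (e1 + e1))"
        using e1 by (simp add: ennreal_mult'[symmetric] ennreal_plus[symmetric] del: ennreal_plus)
      also have "(2 powr p * 2 powr p) * (e1 + e1) = e" by (simp add: e1_def)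
      finally show ?thesis .
    qed
    then show ?thesis using R1(1) R2 by (intro exI[of _ "1 + 2 * R1 + 2 * R2"]) auto
  qed
  obtain r l where r: "strict_mono (r :: nat \<Rightarrow> nat)" and l: "l \<in> Pp p" "(\<lambda>n. Wp p (la (r n)) l) \<longlonglongrightarrow> 0"
    using Wp_convergent_subsequence[OF p prob sets bound powr_ge_zero tail] by blast
  have rt: "filterlim r at_top sequentially" using r by (rule filterlim_subseq)
  show ?thesis
  proof (rule that[of "\<lambda>n. t (r n)" "\<lambda>n. 2 * \<delta> (r n)" l "\<lambda>n. la (r n)"])
    have "filterlim t at_top sequentially"
      unfolding t_def
      by (rule filterlim_tendsto_add_at_top[of "\<lambda>_. 2 * c0 + 4" _ _ real, THEN filterlim_cong[THEN iffD1, rotated -1]])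
         (auto simp: filterlim_real_sequentially add.commute)
    then show "filterlim (\<lambda>n. t (r n)) at_top sequentially" by (rule filterlim_compose[OF _ rt])
    have "\<delta> \<longlonglongrightarrow> 0" unfolding \<delta>_def using LIMSEQ_inverse_real_of_nat by (simp add: inverse_eq_divide)
    then have "(\<lambda>n. 2 * \<delta> (r n)) \<longlonglongrightarrow> 2 * 0"
      by (intro tendsto_mult tendsto_const filterlim_compose[OF _ rt])
    then show "(\<lambda>n. 2 * \<delta> (r n)) \<longlonglongrightarrow> 0" by simp
  qed (use l in_Pp t W1 W2 in \<open>auto simp: la_def T_def less_imp_le\<close>)
qed

lemma busemann_step:
  fixes \<mu> :: "real \<Rightarrow> 'a measure"
  assumes p: "p > 1" and len: "length_space TYPE('a)" and ray: "unit_speed_ray p \<mu>" and \<nu>: "\<nu> \<in> Pp p"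
  obtains l where "l \<in> Pp p" "Wp p \<nu> l = 1" "busemann p \<mu> l = busemann p \<mu> \<nu> - 1"
proof -
  obtain la t \<delta> l where t: "filterlim t at_top sequentially" and \<delta>: "\<delta> \<longlonglongrightarrow> 0" and l: "l \<in> Pp p"
    and la: "\<And>n::nat. la n \<in> Pp p" and t0: "\<And>n. 0 \<le> t n"
    and W1: "\<And>n. Wp p \<nu> (la n) \<le> 1 + \<delta> n"
    and W2: "\<And>n. Wp p (la n) (\<mu> (t n)) \<le> Wp p \<nu> (\<mu> (t n)) - 1 + \<delta> n"
    and conv: "(\<lambda>n. Wp p (la n) l) \<longlonglongrightarrow> 0"
    using interpolants_along_ray[OF p len ray \<nu>] by metis
  have "Wp p \<nu> l \<le> 1 + 0 + 0"
  proof (rule tendsto_lowerbound[OF tendsto_add[OF tendsto_add[OF tendsto_const \<delta>] conv]])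
    show "\<forall>\<^sub>F n in sequentially. Wp p \<nu> l \<le> 1 + \<delta> n + Wp p (la n) l"
    proof (intro always_eventually allI)
      fix n
      show "Wp p \<nu> l \<le> 1 + \<delta> n + Wp p (la n) l"
        using Wp_triangle[OF p \<nu> la[of n] l] W1[of n] by linarith
    qed
  qed simp
  \<comment> \<open>The Busemann function at the fixed limit \<open>l\<close> is bounded by its
    value at the finite time \<open>t n\<close>, which may move with \<open>n\<close>; no limits are
    interchanged.\<close>
  moreover have "busemann p \<mu> l \<le> 0 + (busemann p \<mu> \<nu> - 1) + 0"
  proof (rule tendsto_lowerbound[OF tendsto_add[OF tendsto_add[OF conv tendsto_diff[OF
            filterlim_compose[OF busemann_limit(1)[OF p ray \<nu>] t] tendsto_const]] \<delta>]])
    show "\<forall>\<^sub>F n in sequentially.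
        busemann p \<mu> l \<le> Wp p (la n) l + (Wp p \<nu> (\<mu> (t n)) - t n - 1) + \<delta> n"
    proof (intro always_eventually allI)
      fix n
      have \<mu>: "\<mu> (t n) \<in> Pp p" using unit_speed_rayD(1)[OF ray t0] .
      show "busemann p \<mu> l \<le> Wp p (la n) l + (Wp p \<nu> (\<mu> (t n)) - t n - 1) + \<delta> n"
        using busemann_limit(2)[OF p ray l t0[of n]] Wp_triangle[OF p l la[of n] \<mu>] W2[of n]
          Wp_commute[OF p la[of n] l] by linarith
    qed
  qed simp
  moreover have "busemann p \<mu> \<nu> \<le> Wp p \<nu> l + busemann p \<mu> l"
    by (rule busemann_le_Wp_add[OF p ray \<nu> l])
  ultimately have "Wp p \<nu> l = 1" "busemann p \<mu> l = busemann p \<mu> \<nu> - 1" by linarith+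
  then show ?thesis using that l by blast
qed

end

theorem theorem5p8:
  fixes p :: real and \<mu> :: "real \<Rightarrow> 'a::metric_space measure"
  assumes "Topological_Spaces.complete (UNIV :: 'a set)"
    and "separable_space (euclidean :: 'a topology)"
    and "\<not> compact (UNIV :: 'a set)"
    and "locally_compact_space (euclidean :: 'a topology)"
    and "length_space TYPE('a)"
    and "p > 1"
    and "unit_speed_ray p \<mu>"
  shows "metric_viscosity (Pp p) (Wp p) (busemann p \<mu>)"
proof -
  obtain S :: "'a set" where S: "countable S" "closure S = UNIV"
    using assms(2) by (auto simp: separable_space_def)
  have "S \<noteq> {}" using S(2) by auto
  interpret proper_space "from_nat_into S"
  proof
    fix x :: 'a and e :: real assume "0 < e"
    then obtain y where "y \<in> S" "dist y x < e"
      using S(2) closure_approachable[of x S] by auto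
    moreover obtain i where "from_nat_into S i = y"
      using from_nat_into_surj[OF S(1) \<open>y \<in> S\<close>] by blast
    ultimately show "\<exists>i. dist x (from_nat_into S i) < e" by (auto simp: dist_commute)
  qed (use assms Hopf_Rinow_compact_cball in auto)
  show ?thesis
    unfolding metric_viscosity_def
  proof
    fix \<nu> :: "'a measure" assume \<nu>: "\<nu> \<in> Pp p"
    obtain l where l: "l \<in> Pp p" "Wp p \<nu> l = 1" "busemann p \<mu> l = busemann p \<mu> \<nu> - 1"
      using busemann_step[OF assms(6,5,7) \<nu>] .
    \<comment> \<open>The minimum excludes \<open>\<nu>\<close>; the step of length exactly 1 keeps
      the minimizer away from it.\<close>
    have "l \<noteq> \<nu>" using l(2) Wp_refl[OF assms(6) \<nu>] by auto
    then show "\<exists>z\<in>Pp p - {\<nu>}. busemann p \<mu> \<nu> = Wp p \<nu> z + busemann p \<mu> z \<and>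
        (\<forall>z'\<in>Pp p - {\<nu>}. Wp p \<nu> z + busemann p \<mu> z \<le> Wp p \<nu> z' + busemann p \<mu> z')"
      using l busemann_le_Wp_add[OF assms(6,7) \<nu>] by (intro bexI[of _ l]) auto
  qed
qed

end
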